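(* For every $\varepsilon > 0$ there exists an $\alpha > 0$ such that $$h(G \cup \mathbb{G}(n,p)) = \Omega\left(\frac{n}{\sqrt{\log n}\cdot \max\left\{\sqrt{\alpha(G)},\; \log n\right\}}\right)$$ holds asymptotically almost surely, whenever $p := p(n) = \frac{1+\varepsilon}{n}$ and $G$ is an $n$-vertex graph satisfying $\alpha(G) \leq \alpha n$.
   Context: $\mathbb{G}(n,p)$ is the binomial random graph on the same $n$-element vertex set as $G$ (each pair is an edge independently with probability $p$), and $G \cup \mathbb{G}(n,p)$ is the random graph $G \cup R$ (union of edge sets) with $R \sim \mathbb{G}(n,p)$. A graph $H$ is a minor of a graph $K$ if $H$ can be obtained from a subgraph of $K$ through a series of edge-contractions. The Hadwiger number $h(K)$ is the largest integer $r$ such that $K$ contains the complete graph $K_r$ as a minor. $\alpha(G)$ is the independence number of $G$ (whereas $\alpha$ without argument is a constant). "Asymptotically almost surely" means with probability tending to $1$ as $n \to \infty$, for every choice of $n$-vertex graphs $G = G_n$ satisfying the hypotheses. The constant implicit in $\Omega$ is positive and does not depend on $n$ or $G$ (it may depend on $\varepsilon$). $\log$ is the natural logarithm. *)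

theory Defs
  imports "HOL-Probability.Probability" "HOL-Probability.Product_PMF"
begin

record 'a graph =
  verts :: "'a set"
  edges :: "'a set set"

definition all_pairs :: "'a set \<Rightarrow> 'a set set" where
  "all_pairs V = {e. e \<subseteq> V \<and> card e = 2}"

definition simple_graph :: "'a graph \<Rightarrow> bool" where
  "simple_graph G \<longleftrightarrow> finite (verts G) \<and> edges G \<subseteq> all_pairs (verts G)"

definition subgraph :: "'a graph \<Rightarrow> 'a graph \<Rightarrow> bool" where
  "subgraph H G \<longleftrightarrow> simple_graph H \<and> verts H \<subseteq> verts G \<and> edges H \<subseteq> edges G"

definition graph_union :: "'a graph \<Rightarrow> 'a graph \<Rightarrow> 'a graph" where
  "graph_union G H = \<lparr>verts = verts G \<union> verts H, edges = edges G \<union> edges H\<rparr>"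

definition graph_iso :: "'a graph \<Rightarrow> 'b graph \<Rightarrow> bool" where
  "graph_iso G H \<longleftrightarrow>
     (\<exists>f. bij_betw f (verts G) (verts H) \<and> edges H = (\<lambda>e. f ` e) ` edges G)"

definition complete_graph :: "nat \<Rightarrow> nat graph" where
  "complete_graph r = \<lparr>verts = {..<r}, edges = all_pairs {..<r}\<rparr>"

definition independent_set :: "'a graph \<Rightarrow> 'a set \<Rightarrow> bool" where
  "independent_set G S \<longleftrightarrow> S \<subseteq> verts G \<and> (\<forall>e\<in>edges G. \<not> e \<subseteq> S)"

definition independence_number :: "'a graph \<Rightarrow> nat" where
  "independence_number G = Max (card ` {S. independent_set G S})"

text \<open>Contraction of the edge \<open>{u, v}\<close>: the vertex \<open>v\<close> is identified with \<open>u\<close>, which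
  represents the merged vertex.  Parallel edges coincide as sets, and the only loop that
  arises is the image \<open>{u}\<close> of \<open>{u, v}\<close>.\<close>

definition contract_edge :: "'a \<Rightarrow> 'a \<Rightarrow> 'a graph \<Rightarrow> 'a graph" where
  "contract_edge u v G =
     \<lparr>verts = verts G - {v},
      edges = (\<lambda>e. (\<lambda>x. if x = v then u else x) ` e) ` edges G - {{u}}\<rparr>"

definition contraction_step :: "'a graph \<Rightarrow> 'a graph \<Rightarrow> bool" where
  "contraction_step G H \<longleftrightarrow>
     (\<exists>u v. u \<noteq> v \<and> {u, v} \<in> edges G \<and> H = contract_edge u v G)"

definition is_minor :: "'b graph \<Rightarrow> 'a graph \<Rightarrow> bool" where
  "is_minor H K \<longleftrightarrow>
     (\<exists>K' H'. subgraph K' K \<and> contraction_step\<^sup>*\<^sup>* K' H' \<and> graph_iso H' H)"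

definition hadwiger_number :: "'a graph \<Rightarrow> nat" where
  "hadwiger_number K = (GREATEST r. is_minor (complete_graph r) K)"

text \<open>For \<open>p\<close> outside the unit interval, \<open>bernoulli_pmf\<close> truncates \<open>p\<close> to it.\<close>

definition binomial_random_graph :: "'a set \<Rightarrow> real \<Rightarrow> 'a graph pmf" where
  "binomial_random_graph V p =
     map_pmf (\<lambda>present. \<lparr>verts = V, edges = {e \<in> all_pairs V. present e}\<rparr>)
       (Pi_pmf (all_pairs V) False (\<lambda>_. bernoulli_pmf p))"


text \<open>For simple graphs the maxima above are attained.\<close>

lemma independent_set_empty: "simple_graph G \<Longrightarrow> independent_set G {}"
  by (auto simp: independent_set_def simple_graph_def all_pairs_def)

lemma finite_independent_sets: "simple_graph G \<Longrightarrow> finite {S. independent_set G S}"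
  by (rule finite_subset[of _ "Pow (verts G)"]) (auto simp: independent_set_def simple_graph_def)

lemma simple_graph_contract_edge:
  assumes "simple_graph G" "{u, v} \<in> edges G" "u \<noteq> v"
  shows "simple_graph (contract_edge u v G)"
proof -
  let ?f = "\<lambda>x. if x = v then u else x"
  have u: "u \<in> verts G"
    using assms by (auto simp: simple_graph_def all_pairs_def)
  have "?f ` e \<in> all_pairs (verts G - {v})" if e: "e \<in> edges G" "?f ` e \<noteq> {u}" for e
  proof -
    from e assms have "e \<subseteq> verts G" "card e = 2"
      by (auto simp: simple_graph_def all_pairs_def)
    have "?f ` e \<subseteq> verts G - {v}"
      using \<open>e \<subseteq> verts G\<close> u assms(3) by auto
    moreover have "inj_on ?f e"
    proof (rule ccontr)
      assume "\<not> inj_on ?f e"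
      then have "{u, v} \<subseteq> e"
        by (auto simp: inj_on_def split: if_splits)
      moreover have "finite e"
        using \<open>card e = 2\<close> card.infinite by force
      ultimately have "{u, v} = e"
        using \<open>card e = 2\<close> assms(3) by (intro card_subset_eq) auto
      then have "?f ` e = {u}"
        by auto
      with e(2) show False
        by contradiction
    qed
    ultimately show ?thesis
      using \<open>card e = 2\<close> unfolding all_pairs_def by (simp only: card_image mem_Collect_eq simp_thms)
  qed
  then show ?thesis
    using assms(1) by (auto simp: simple_graph_def contract_edge_def)
qed

lemma is_minor_complete_graph_0: "is_minor (complete_graph 0) K"
  unfolding is_minor_def
proof (intro exI conjI)
  show "subgraph \<lparr>verts = {}, edges = {}\<rparr> K"
    by (simp add: subgraph_def simple_graph_def)
  show "graph_iso \<lparr>verts = {}, edges = {}\<rparr> (complete_graph 0)"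
    by (auto simp: graph_iso_def complete_graph_def all_pairs_def bij_betw_def)
qed simp

lemma is_minor_complete_graph_le_card:
  assumes "finite (verts K)" "is_minor (complete_graph r) K"
  shows "r \<le> card (verts K)"
proof -
  obtain K' H' where *: "subgraph K' K" "contraction_step\<^sup>*\<^sup>* K' H'" "graph_iso H' (complete_graph r)"
    using assms(2) by (auto simp: is_minor_def)
  have "verts H' \<subseteq> verts K'"
    using *(2) by induction (auto simp: contraction_step_def contract_edge_def)
  then have "verts H' \<subseteq> verts K"
    using *(1) by (auto simp: subgraph_def)
  moreover have "card (verts H') = r"
    using *(3) by (auto simp: graph_iso_def complete_graph_def dest: bij_betw_same_card)
  ultimately show ?thesis
    using assms(1) card_mono by blast
qed

lemma hadwiger_number_attained:
  assumes "finite (verts K)"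
  shows "is_minor (complete_graph (hadwiger_number K)) K"
  unfolding hadwiger_number_def
  by (rule GreatestI_nat[where P = "\<lambda>r. is_minor (complete_graph r) K", OF is_minor_complete_graph_0])
    (use is_minor_complete_graph_le_card[OF assms] in blast)

lemma le_hadwiger_number:
  assumes "finite (verts K)" "is_minor (complete_graph r) K"
  shows "r \<le> hadwiger_number K"
  unfolding hadwiger_number_def
  by (rule Greatest_le_nat[where P = "\<lambda>r. is_minor (complete_graph r) K", OF assms(2)])
    (use is_minor_complete_graph_le_card[OF assms(1)] in blast)

end

(*
Let a = alpha(G).  A greedy choice of disjoint connected sets of K = 128 vertices in G ("pieces")
covers at least half of the vertices: the rest has only components with fewer than K vertices,
hence contains an independent set of proportional size.  Whp any two disjoint quarters of the N
pieces are joined by an edge of the random graph, so depth-first search yields a path through at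
least N/2 pieces.  The law of the random graph is invariant under permuting the pieces, so this
path visits them in uniformly random order.  Cut it into segments of t pieces and take them as
branch sets.  In the graph induced by G on the pieces every half of the vertex set contains many
vertices of degree at least N/(8a) inside it; exposing the first of two random segments piece by
piece shows that the two are joined by an edge of G except with probability about
exp(-t^2/(128a)) + exp(-t/16).  For t of order sqrt(log n) max(sqrt a, log n) a union bound over
all pairs of segments finishes the proof.
*)

theory Submission
  imports Defs "HOL-Real_Asymp.Real_Asymp"
begin

text \<open>With edge probability of order 1/n a single vertex has bounded expected degree in the
  random graph. Grouping vertices into connected pieces of a large constant size raises the expected
  degree between pieces, so that a path through half of them fails to exist only with exponentially
  small probability.

  The obstacle is that the path depends on the random graph while \<open>G\<close> is arbitrary:
  some orders of the pieces may be bad for \<open>G\<close>. Although \<open>G\<close> need not have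
  any symmetry, the random graph does. All pieces have the same size, so every permutation of them
  lifts to a permutation of the vertices, and this preserves the law of the random graph. Hence
  \<open>G\<close> meets the path in a uniformly random position.

  The union bound runs over at most n^2 pairs of segments, so t^2 / a and t must both be large
  multiples of log n. The chosen t is at least of order sqrt(a log n) and of order log n, and the
  number of branch sets is proportional to n / t.\<close>

section \<open>Minors from branch sets\<close>

text \<open>Connectivity by cuts rather than by paths: it survives enlarging the edge set, gluing
  along an edge, and contraction, where a cut of the contracted set pulls back to a cut of the
  original one.\<close>

definition cut_connected :: "'a set set \<Rightarrow> 'a set \<Rightarrow> bool" where
  "cut_connected E B \<longleftrightarrow>
     (\<forall>C. C \<subset> B \<and> C \<noteq> {} \<longrightarrow> (\<exists>u\<in>C. \<exists>v\<in>B - C. {u, v} \<in> E))"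

lemma cut_connected_singleton: "cut_connected E {x}"
  unfolding cut_connected_def by blast

lemma cut_connected_mono: "cut_connected E B \<Longrightarrow> E \<subseteq> E' \<Longrightarrow> cut_connected E' B"
  unfolding cut_connected_def by blast

lemma cut_connected_Un:
  assumes A: "cut_connected E A" and B: "cut_connected E B"
    and ab: "a \<in> A" "b \<in> B" "{a, b} \<in> E"
  shows "cut_connected E (A \<union> B)"
  unfolding cut_connected_def
proof (intro allI impI)
  fix C assume C: "C \<subset> A \<union> B \<and> C \<noteq> {}"
  have ba: "{b, a} \<in> E" using ab(3) by (simp add: insert_commute)
  consider (A) "C \<inter> A \<noteq> {}" "C \<inter> A \<noteq> A" | (B) "C \<inter> B \<noteq> {}" "C \<inter> B \<noteq> B"
    | (AB) "(C \<inter> A = {} \<or> C \<inter> A = A)" "(C \<inter> B = {} \<or> C \<inter> B = B)"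
    by blast
  then show "\<exists>u\<in>C. \<exists>v\<in>A \<union> B - C. {u, v} \<in> E"
  proof cases
    case A
    then have "C \<inter> A \<subset> A \<and> C \<inter> A \<noteq> {}" by blast
    then obtain u v where "u \<in> C \<inter> A" "v \<in> A - C \<inter> A" "{u, v} \<in> E"
      using assms(1) unfolding cut_connected_def by blast
    then show ?thesis by blast
  next
    case B
    then have "C \<inter> B \<subset> B \<and> C \<inter> B \<noteq> {}" by blast
    then obtain u v where "u \<in> C \<inter> B" "v \<in> B - C \<inter> B" "{u, v} \<in> E"
      using assms(2) unfolding cut_connected_def by blast
    then show ?thesis by blast
  next
    case AB
    have "\<not> (C \<inter> A = {} \<and> C \<inter> B = {})" "\<not> (C \<inter> A = A \<and> C \<inter> B = B)" using C by blast+
    with AB consider "C \<inter> A = A" "C \<inter> B = {}" | "C \<inter> A = {}" "C \<inter> B = B" by blast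
    then show ?thesis
    proof cases
      case 1 then show ?thesis using ab by blast
    next
      case 2 then show ?thesis using ab ba by blast
    qed
  qed
qed

lemma cut_connected_Union_path:
  assumes "vs \<noteq> []" "\<And>B. B \<in> set vs \<Longrightarrow> cut_connected E B"
    and "successively (\<lambda>A B. \<exists>a\<in>A. \<exists>b\<in>B. {a, b} \<in> E) vs"
  shows "cut_connected E (\<Union>(set vs))"
  using assms
proof (induction vs)
  case (Cons A vs)
  show ?case
  proof (cases vs)
    case Nil
    then show ?thesis using Cons.prems by simp
  next
    case (Cons B us)
    have "cut_connected E (\<Union>(set vs))"
      by (rule Cons.IH) (use Cons Cons.prems in auto)
    moreover obtain a b where "a \<in> A" "b \<in> B" "{a, b} \<in> E"
      using Cons Cons.prems by auto
    ultimately have "cut_connected E (A \<union> \<Union>(set vs))"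
      using Cons Cons.prems by (intro cut_connected_Un[of E A "\<Union>(set vs)" a b]) auto
    then show ?thesis by simp
  qed
qed simp

lemma edge_contract_edge:
  fixes u v :: 'a
  defines "f \<equiv> (\<lambda>x. if x = v then u else x)"
  assumes "{x, y} \<in> edges G" "f x \<noteq> f y"
  shows "{f x, f y} \<in> edges (contract_edge u v G)"
proof -
  have "{f x, f y} = f ` {x, y}" by simp
  with assms(2) have "{f x, f y} \<in> (\<lambda>e. f ` e) ` edges G" by blast
  moreover have "{f x, f y} \<noteq> {u}" using assms(3) by auto
  ultimately show ?thesis unfolding contract_edge_def f_def by simp
qed

text \<open>Induction on the number of vertices. The cut isolating one vertex of a non-singleton
  branch set provides an edge inside that set, and contracting it keeps all hypotheses. Once every
  branch set is a singleton, all pairs are edges and the graph is complete. A contraction never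
  discards a branch set or an outside vertex, which is why the branch sets are required to cover
  \<open>verts G\<close>.\<close>

lemma contract_to_complete_graph:
  assumes "simple_graph G" "verts G = (\<Union>i<r. B i)"
    and "\<And>i. i < r \<Longrightarrow> B i \<noteq> {}"
    and "\<And>i. i < r \<Longrightarrow> cut_connected (edges G) (B i)"
    and "disjoint_family_on B {..<r}"
    and "\<And>i j. i < j \<Longrightarrow> j < r \<Longrightarrow> \<exists>x\<in>B i. \<exists>y\<in>B j. {x, y} \<in> edges G"
  shows "\<exists>H. contraction_step\<^sup>*\<^sup>* G H \<and> graph_iso H (complete_graph r)"
  using assms
proof (induction "card (verts G)" arbitrary: G B rule: less_induct)
  case less
  note fin = less.prems(1)[unfolded simple_graph_def, THEN conjunct1]
  have uniq: "i = j" if "x \<in> B i" "x \<in> B j" "i < r" "j < r" for x i j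
    using less.prems(5) that unfolding disjoint_family_on_def by blast
  show ?case
  proof (cases "\<exists>i<r. \<exists>u\<in>B i. B i \<noteq> {u}")
    case True
    then obtain i u where i: "i < r" "u \<in> B i" "{u} \<subset> B i" by blast
    then obtain v where v: "v \<in> B i - {u}" "{u, v} \<in> edges G"
      using less.prems(4)[OF i(1)] unfolding cut_connected_def by blast
    let ?f = "\<lambda>x. if x = v then u else x"
    let ?G = "contract_edge u v G"
    define B' where "B' j = B j - {v}" for j
    \<comment> \<open>The renaming respects the branch sets because \<open>u\<close> and
      \<open>v\<close> both lie in \<open>B i\<close>.\<close>
    have fB: "?f x \<in> B' j" if "x \<in> B j" "j < r" for x j
      using that uniq[of v j i] v i by (auto simp: B'_def)
    have adj: "{?f x, ?f y} \<in> edges ?G" if "{x, y} \<in> edges G" "?f x \<noteq> ?f y" for x y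
      using edge_contract_edge[OF that] .
    have "u \<noteq> v" using v by blast
    have vV: "v \<in> verts G" using v i less.prems(2) by blast
    have step: "contraction_step G ?G"
      unfolding contraction_step_def using v \<open>u \<noteq> v\<close> by blast
    have "\<exists>H. contraction_step\<^sup>*\<^sup>* ?G H \<and> graph_iso H (complete_graph r)"
    proof (rule less.hyps[of _ B'])
      show "card (verts ?G) < card (verts G)"
        using card_Diff1_less[OF fin vV] by (simp only: contract_edge_def graph.select_convs)
      show "simple_graph ?G"
        by (rule simple_graph_contract_edge) (use less.prems v \<open>u \<noteq> v\<close> in auto)
      show "verts ?G = (\<Union>j<r. B' j)"
        using less.prems(2) by (auto simp: contract_edge_def B'_def)
      show "B' j \<noteq> {}" if "j < r" for j
        using less.prems(3)[OF that] fB that by blast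
      show "disjoint_family_on B' {..<r}"
        using less.prems(5) by (auto simp: disjoint_family_on_def B'_def)
      show "\<exists>x\<in>B' j. \<exists>y\<in>B' k. {x, y} \<in> edges ?G" if "j < k" "k < r" for j k
      proof -
        obtain x y where xy: "x \<in> B j" "y \<in> B k" "{x, y} \<in> edges G"
          using less.prems(6)[OF \<open>j < k\<close> \<open>k < r\<close>] by blast
        have x: "?f x \<in> B' j" and y: "?f y \<in> B' k" using fB xy that by auto
        then have "?f x \<noteq> ?f y" using uniq[of _ j k] that by (auto simp: B'_def)
        from adj[OF xy(3) this] x y show ?thesis by blast
      qed
      show "cut_connected (edges ?G) (B' j)" if "j < r" for j
        unfolding cut_connected_def
      proof (intro allI impI)
        fix C assume C: "C \<subset> B' j \<and> C \<noteq> {}"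
        \<comment> \<open>The preimage of \<open>C\<close> under the renaming: an edge across this
          cut of \<open>B j\<close> is mapped to an edge across \<open>C\<close>, and its ends stay
          distinct.\<close>
        define C' where "C' = {x \<in> B j. ?f x \<in> C}"
        have CC: "C \<subseteq> C'" using C by (auto simp: C'_def B'_def)
        have "C' \<noteq> B j" using C fB[OF _ that] by (auto simp: C'_def B'_def)
        moreover have "C' \<subseteq> B j" by (auto simp: C'_def)
        moreover have "C' \<noteq> {}" using CC C by blast
        ultimately have "C' \<subset> B j \<and> C' \<noteq> {}" by blast
        then obtain x y where xy: "x \<in> C'" "y \<in> B j - C'" "{x, y} \<in> edges G"
          using less.prems(4)[OF \<open>j < r\<close>] unfolding cut_connected_def by blast
        have x: "?f x \<in> C" using xy by (simp add: C'_def)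
        have y: "?f y \<in> B' j - C" using xy fB[OF _ that, of y] by (simp add: C'_def)
        have "?f x \<noteq> ?f y" using x y by (metis DiffD2)
        from adj[OF xy(3) this] x y show "\<exists>u\<in>C. \<exists>v\<in>B' j - C. {u, v} \<in> edges ?G" by blast
      qed
    qed
    then show ?thesis using step by (meson converse_rtranclp_into_rtranclp)
  next
    case False
    define b where "b i = (THE u. B i = {u})" for i
    have b: "B i = {b i}" if i: "i < r" for i
    proof -
      obtain u where "B i = {u}" using less.prems(3)[OF i] False i by blast
      then show ?thesis by (simp add: b_def)
    qed
    have V: "verts G = b ` {..<r}" using less.prems(2) b by auto
    have inj: "inj_on b {..<r}"
    proof (rule inj_onI)
      fix i j assume "i \<in> {..<r}" "j \<in> {..<r}" "b i = b j"
      then show "i = j" using uniq[of "b i" i j] b by auto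
    qed
    have E1: "{b i, b j} \<in> edges G" if "i < r" "j < r" "i \<noteq> j" for i j
    proof (cases "i < j")
      case True
      then show ?thesis using less.prems(6)[of i j] b that by auto
    next
      case False
      then have "{b j, b i} \<in> edges G" using less.prems(6)[of j i] b that by auto
      then show ?thesis by (simp add: insert_commute)
    qed
    let ?g = "the_inv_into {..<r} b"
    have bij: "bij_betw ?g (verts G) {..<r}"
      using inj V by (simp add: bij_betw_the_inv_into bij_betw_imageI)
    have gb: "?g (b i) = i" if "i < r" for i
      using that inj by (simp add: the_inv_into_f_f)
    have "edges (complete_graph r) = (\<lambda>e. ?g ` e) ` edges G"
    proof (intro equalityI subsetI)
      fix e assume "e \<in> edges (complete_graph r)"
      then have "e \<subseteq> {..<r}" "card e = 2" by (auto simp: complete_graph_def all_pairs_def)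
      then obtain i j where ij: "e = {i, j}" "i \<noteq> j" "i < r" "j < r"
        by (auto simp: card_2_iff)
      then have "e = ?g ` {b i, b j}" using gb by simp
      then show "e \<in> (\<lambda>e. ?g ` e) ` edges G" using E1[of i j] ij by blast
    next
      fix e assume "e \<in> (\<lambda>e. ?g ` e) ` edges G"
      then obtain e' where e': "e' \<in> edges G" "e = ?g ` e'" by blast
      then have e2: "e' \<subseteq> verts G" "card e' = 2"
        using less.prems(1) by (auto simp: simple_graph_def all_pairs_def)
      have "inj_on ?g e'" using bij e2(1) by (meson bij_betw_def inj_on_subset)
      then have "card e = 2" using e2 e' by (simp add: card_image)
      moreover have "e \<subseteq> {..<r}" using e2 e' bij by (auto simp: bij_betw_def)
      ultimately show "e \<in> edges (complete_graph r)"
        by (simp add: complete_graph_def all_pairs_def)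
    qed
    with bij have "graph_iso G (complete_graph r)"
      unfolding graph_iso_def by (intro exI[of _ ?g]) (simp add: complete_graph_def)
    then show ?thesis by blast
  qed
qed

lemma complete_minor_of_branch_sets:
  assumes "simple_graph G"
    and "\<And>i. i < r \<Longrightarrow> B i \<subseteq> verts G"
    and "\<And>i. i < r \<Longrightarrow> B i \<noteq> {}"
    and "\<And>i. i < r \<Longrightarrow> cut_connected (edges G) (B i)"
    and "disjoint_family_on B {..<r}"
    and "\<And>i j. i < j \<Longrightarrow> j < r \<Longrightarrow> \<exists>x\<in>B i. \<exists>y\<in>B j. {x, y} \<in> edges G"
  shows "is_minor (complete_graph r) G"
proof -
  define U where "U = (\<Union>i<r. B i)"
  \<comment> \<open>Vertices outside all branch sets are removed here, by the subgraph half of the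
    minor relation.\<close>
  define K where "K = \<lparr>verts = U, edges = {e \<in> edges G. e \<subseteq> U}\<rparr>"
  have U: "U \<subseteq> verts G" using assms(2) by (auto simp: U_def)
  have simple: "simple_graph K"
    using assms(1) U finite_subset by (auto simp: simple_graph_def K_def all_pairs_def)
  have sub: "subgraph K G"
    using simple U by (auto simp: subgraph_def K_def)
  have edge: "{x, y} \<in> edges K" if "{x, y} \<in> edges G" "x \<in> B i" "y \<in> B j" "i < r" "j < r" for x y i j
    using that by (auto simp: K_def U_def)
  have "\<exists>H. contraction_step\<^sup>*\<^sup>* K H \<and> graph_iso H (complete_graph r)"
  proof (rule contract_to_complete_graph[OF simple])
    show "verts K = (\<Union>i<r. B i)" by (simp add: K_def U_def)
    show "cut_connected (edges K) (B i)" if "i < r" for i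
      unfolding cut_connected_def
    proof (intro allI impI)
      fix C assume C: "C \<subset> B i \<and> C \<noteq> {}"
      obtain x y where "x \<in> C" "y \<in> B i - C" "{x, y} \<in> edges G"
        using assms(4)[OF \<open>i < r\<close>] C unfolding cut_connected_def by blast
      moreover then have "{x, y} \<in> edges K" using C edge that by blast
      ultimately show "\<exists>u\<in>C. \<exists>v\<in>B i - C. {u, v} \<in> edges K" by blast
    qed
    show "\<exists>x\<in>B i. \<exists>y\<in>B j. {x, y} \<in> edges K" if "i < j" "j < r" for i j
      using assms(6)[OF that] edge[of _ _ i j] that by (meson less_trans)
  qed (use assms in auto)
  then show ?thesis using sub unfolding is_minor_def by blast
qed

section \<open>Independent sets, connected pieces and long paths\<close>

lemma card_le_independence_number:
  assumes "simple_graph G" "independent_set G S"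
  shows "card S \<le> independence_number G"
  unfolding independence_number_def
  using assms finite_independent_sets by (intro Max_ge) auto

lemma obtain_max_card:
  assumes "finite F" "A \<in> F"
  obtains C where "C \<in> F" "\<And>D. D \<in> F \<Longrightarrow> card D \<le> card C"
proof -
  have "Max (card ` F) \<in> card ` F" using assms by (intro Max_in) auto
  then obtain C where "C \<in> F" "card C = Max (card ` F)" by auto
  then show ?thesis using that assms(1) by simp
qed

text \<open>A largest connected set of at most \<open>K\<close> vertices around \<open>u\<close> has
  fewer than \<open>K\<close> of them, so an edge leaving it inside \<open>U\<close> would allow an
  extension. Keeping only \<open>u\<close> from this set and recursing on the rest pays at most
  \<open>K\<close> vertices of \<open>U\<close> per element of \<open>I\<close>.\<close>

lemma independent_set_if_no_connected_subset:
  assumes G: "simple_graph G" and "U \<subseteq> verts G" "K > 0"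
    and "\<And>C. C \<subseteq> U \<Longrightarrow> cut_connected (edges G) C \<Longrightarrow> card C \<noteq> K"
  shows "\<exists>I\<subseteq>U. independent_set G I \<and> card U \<le> K * card I"
  using assms(2,4)
proof (induction "card U" arbitrary: U rule: less_induct)
  case less
  have fin: "finite U" using less.prems(1) G finite_subset by (auto simp: simple_graph_def)
  show ?case
  proof (cases "U = {}")
    case True
    then show ?thesis using independent_set_empty[OF G] by auto
  next
    case False
    then obtain u where u: "u \<in> U" by blast
    define F where "F = {C. C \<subseteq> U \<and> u \<in> C \<and> cut_connected (edges G) C \<and> card C \<le> K}"
    have "finite F" using fin by (auto simp: F_def)
    moreover have "{u} \<in> F" using u \<open>K > 0\<close> by (auto simp: F_def cut_connected_singleton)
    ultimately obtain C where C: "C \<in> F" and Cmax: "\<And>D. D \<in> F \<Longrightarrow> card D \<le> card C"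
      by (meson obtain_max_card)
    have CU: "C \<subseteq> U" "u \<in> C" "cut_connected (edges G) C" "card C \<le> K" using C by (auto simp: F_def)
    then have "card C < K" using less.prems(2)[of C] by auto
    have finC: "finite C" using CU fin finite_subset by auto
    have no: "{x, y} \<notin> edges G" if "x \<in> C" "y \<in> U - C" for x y
    proof
      assume "{x, y} \<in> edges G"
      then have "cut_connected (edges G) (C \<union> {y})"
        using CU that by (intro cut_connected_Un[of _ C "{y}" x y] cut_connected_singleton) auto
      then have "insert y C \<in> F" using CU that \<open>card C < K\<close> finC by (auto simp: F_def)
      from Cmax[OF this] show False using that finC by auto
    qed
    have "\<exists>I\<subseteq>U - C. independent_set G I \<and> card (U - C) \<le> K * card I"
    proof (rule less.hyps)
      show "card (U - C) < card U"
        using CU u fin by (intro psubset_card_mono) auto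
    qed (use less.prems in auto)
    then obtain I where I: "I \<subseteq> U - C" "independent_set G I" "card (U - C) \<le> K * card I" by blast
    have "independent_set G (insert u I)"
      unfolding independent_set_def
    proof (intro conjI ballI notI)
      show "insert u I \<subseteq> verts G" using I CU less.prems by auto
      fix e assume e: "e \<in> edges G" "e \<subseteq> insert u I"
      show False
      proof (cases "u \<in> e")
        case True
        have "card e = 2" using G e by (auto simp: simple_graph_def all_pairs_def)
        then obtain y where "e = {u, y}" "u \<noteq> y" using True by (auto simp: card_2_iff)
        then show False using no[of u y] e I CU by auto
      next
        case False
        then show False using e I by (auto simp: independent_set_def)
      qed
    qed
    moreover have "card U \<le> K * card (insert u I)"
    proof -
      have "card U = card C + card (U - C)" using CU finC fin
        by (metis card_Diff_subset card_mono le_add_diff_inverse)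
      also have "\<dots> \<le> K + K * card I" using I CU by auto
      also have "\<dots> = K * card (insert u I)"
        using I CU fin finite_subset[of I "U - C"] by (subst card_insert_disjoint) auto
      finally show ?thesis .
    qed
    ultimately show ?thesis using I u by (intro exI[of _ "insert u I"]) auto
  qed
qed

text \<open>A disjoint family of maximum size leaves no connected \<open>K\<close>-set among the
  uncovered vertices, so the previous lemma turns these into an independent set.\<close>

lemma disjoint_connected_family:
  assumes G: "simple_graph G" and "K > 0"
  shows "\<exists>X. (\<forall>B\<in>X. B \<subseteq> verts G \<and> card B = K \<and> cut_connected (edges G) B) \<and> disjoint X \<and>
    card (verts G) \<le> K * card X + K * independence_number G"
proof -
  have fin: "finite (verts G)" using G by (simp add: simple_graph_def)
  define P where "P = {B. B \<subseteq> verts G \<and> card B = K \<and> cut_connected (edges G) B}"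
  define F where "F = {X. X \<subseteq> P \<and> disjoint X}"
  have "finite P" using fin by (auto simp: P_def)
  then have "finite F" by (auto simp: F_def)
  moreover have "{} \<in> F" by (auto simp: F_def)
  ultimately obtain X where X: "X \<in> F" and Xmax: "\<And>Y. Y \<in> F \<Longrightarrow> card Y \<le> card X"
    by (meson obtain_max_card)
  have XP: "X \<subseteq> P" "disjoint X" using X by (auto simp: F_def)
  have finX: "finite X" using XP \<open>finite P\<close> finite_subset by blast
  define U where "U = verts G - \<Union>X"
  have "card C \<noteq> K" if C: "C \<subseteq> U" "cut_connected (edges G) C" for C
  proof
    assume K: "card C = K"
    have "C \<noteq> {}" using K \<open>K > 0\<close> by auto
    have disj: "C \<inter> B = {}" if "B \<in> X" for B using C that by (auto simp: U_def)
    have "C \<notin> X" using disj[of C] \<open>C \<noteq> {}\<close> by auto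
    have "disjoint (insert C X)"
      using XP(2) disj by (auto simp: disjoint_def)
    moreover have "C \<in> P" using K C by (auto simp: P_def U_def)
    ultimately have "insert C X \<in> F" using XP by (auto simp: F_def)
    from Xmax[OF this] show False using \<open>C \<notin> X\<close> finX by auto
  qed
  then obtain I where I: "I \<subseteq> U" "independent_set G I" "card U \<le> K * card I"
    using independent_set_if_no_connected_subset[OF G, of U K] \<open>K > 0\<close> by (auto simp: U_def)
  have "card (\<Union>X) \<le> (\<Sum>B\<in>X. card B)" by (rule card_Union_le_sum_card)
  also have "\<dots> = K * card X" using XP by (simp add: P_def subset_iff)
  finally have 1: "card (\<Union>X) \<le> K * card X" .
  have "verts G \<subseteq> U \<union> \<Union>X" by (auto simp: U_def)
  then have "card (verts G) \<le> card U + card (\<Union>X)"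
  proof -
    have "finite (U \<union> \<Union>X)" using fin XP finX by (auto simp: U_def P_def intro: finite_subset)
    then have "card (verts G) \<le> card (U \<union> \<Union>X)" using \<open>verts G \<subseteq> U \<union> \<Union>X\<close> by (rule card_mono)
    also have "\<dots> \<le> card U + card (\<Union>X)" by (rule card_Un_le)
    finally show ?thesis .
  qed
  also have "\<dots> \<le> K * independence_number G + K * card X"
    using 1 I(3) card_le_independence_number[OF G I(2)] by (meson add_mono le_trans mult_le_mono2)
  finally show ?thesis using XP by (intro exI[of _ X]) (auto simp: P_def)
qed

text \<open>Greedy choice: each selected vertex removes itself and its fewer than \<open>d\<close>
  neighbours in \<open>L\<close>, at most \<open>d\<close> vertices in all, and degrees only drop in
  the remainder.\<close>

lemma independent_subset_of_small_degree:
  assumes "finite L" and sym: "\<And>x y. adj x y \<Longrightarrow> adj y x"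
    and irr: "\<And>x. \<not> adj x x" and deg: "\<And>x. x \<in> L \<Longrightarrow> card {y\<in>L. adj x y} < d"
  shows "\<exists>I\<subseteq>L. (\<forall>x\<in>I. \<forall>y\<in>I. \<not> adj x y) \<and> card L \<le> d * card I"
  using assms(1,4)
proof (induction "card L" arbitrary: L rule: less_induct)
  case less
  show ?case
  proof (cases "L = {}")
    case False
    then obtain x where x: "x \<in> L" by blast
    define D where "D = insert x {y\<in>L. adj x y}"
    have D: "D \<subseteq> L" "x \<in> D" "finite D" using x less.prems(1) by (auto simp: D_def)
    have cD: "card D \<le> d"
      using less.prems(1) less.prems(2)[OF x] irr by (simp add: D_def)
    have "\<exists>I\<subseteq>L - D. (\<forall>x\<in>I. \<forall>y\<in>I. \<not> adj x y) \<and> card (L - D) \<le> d * card I"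
    proof (rule less.hyps)
      show "card (L - D) < card L" using D x less.prems(1) by (intro psubset_card_mono) auto
      fix y assume y: "y \<in> L - D"
      have "card {z \<in> L - D. adj y z} \<le> card {z\<in>L. adj y z}"
        using less.prems(1) by (intro card_mono) auto
      then show "card {z \<in> L - D. adj y z} < d" using less.prems(2)[of y] y by auto
    qed (use less.prems in auto)
    then obtain I where I: "I \<subseteq> L - D" "\<forall>x\<in>I. \<forall>y\<in>I. \<not> adj x y" "card (L - D) \<le> d * card I" by blast
    have fI: "finite I" using I less.prems(1) finite_subset by blast
    have "x \<notin> I" using I D by auto
    have "\<not> adj x y" if "y \<in> I" for y using that I by (auto simp: D_def)
    then have "\<forall>y\<in>insert x I. \<forall>z\<in>insert x I. \<not> adj y z" using I(2) sym irr by blast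
    moreover have "card L \<le> d * card (insert x I)"
    proof -
      have "card L = card D + card (L - D)" using D less.prems(1)
        by (metis card_Diff_subset card_mono le_add_diff_inverse)
      also have "\<dots> \<le> d + d * card I" using I cD by linarith
      also have "\<dots> = d * card (insert x I)" using fI \<open>x \<notin> I\<close> by simp
      finally show ?thesis .
    qed
    ultimately show ?thesis using I x by (intro exI[of _ "insert x I"]) auto
  qed auto
qed

text \<open>Depth-first search: \<open>S\<close> is the set of finished vertices, \<open>vs\<close> the stack (a path),
  \<open>T\<close> the set of unvisited vertices.  Every move increases \<open>card S - card T\<close> by one,
  so at some moment the two sets have equal size.\<close>

lemma dfs_state:
  assumes "finite X" "j \<le> card X"
  shows "\<exists>S vs T. S \<union> set vs \<union> T = X \<and> S \<inter> set vs = {} \<and> S \<inter> T = {} \<and> set vs \<inter> T = {} \<and>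
    distinct vs \<and> successively adj vs \<and> (\<forall>w\<in>T. \<forall>s\<in>S. \<not> adj w s) \<and> card S + card X = card T + j"
  using assms(2)
proof (induction j)
  case 0
  show ?case by (rule exI[of _ "{}"], rule exI[of _ "[]"], rule exI[of _ X]) simp
next
  case (Suc j)
  then obtain S vs T where st: "S \<union> set vs \<union> T = X" "S \<inter> set vs = {}" "S \<inter> T = {}" "set vs \<inter> T = {}"
    "distinct vs" "successively adj vs" "\<forall>w\<in>T. \<forall>s\<in>S. \<not> adj w s" "card S + card X = card T + j"
    by auto
  have fin: "finite S" "finite T" using st(1) assms(1) by (auto intro: finite_subset)
  consider (push) w where "w \<in> T" "vs = [] \<or> adj w (hd vs)"
    | (pop) v us where "vs = v # us" "\<forall>w\<in>T. \<not> adj w v"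
    | (stuck) "vs = []" "T = {}"
    by (cases vs) auto
  then show ?case
  proof cases
    case push
    have "card S + card X = card (T - {w}) + Suc j"
      using st(8) card_Suc_Diff1[OF fin(2) push(1)] by linarith
    moreover have "S \<union> set (w # vs) \<union> (T - {w}) = X" "S \<inter> set (w # vs) = {}" "S \<inter> (T - {w}) = {}"
      "set (w # vs) \<inter> (T - {w}) = {}" "distinct (w # vs)" "\<forall>w\<in>T - {w}. \<forall>s\<in>S. \<not> adj w s"
      using st(1-5,7) push(1) by auto
    moreover have "successively adj (w # vs)" using st(6) push(2) by (auto simp: successively_Cons)
    ultimately show ?thesis by blast
  next
    case pop
    have "card (insert v S) + card X = card T + Suc j"
      using st pop fin by auto
    moreover have "insert v S \<union> set us \<union> T = X" "insert v S \<inter> set us = {}" "insert v S \<inter> T = {}"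
      "set us \<inter> T = {}" "distinct us" "\<forall>w\<in>T. \<forall>s\<in>insert v S. \<not> adj w s"
      using st(1-5,7) pop by auto
    moreover have "successively adj us" using st(6) pop(1) by (auto simp: successively_Cons)
    ultimately show ?thesis by blast
  next
    case stuck
    then show ?thesis using st Suc.prems by auto
  qed
qed

text \<open>Depth-first search is stopped when the finished and the unvisited set have equal size.
  No adjacency leads from one to the other, so each has at most k - 1 elements and the stack holds
  the rest; this is the source of the summand 2.\<close>

lemma long_path_if_all_large_sets_joined:
  assumes "finite X"
    and "\<And>A B. A \<subseteq> X \<Longrightarrow> B \<subseteq> X \<Longrightarrow> A \<inter> B = {} \<Longrightarrow> card A = k \<Longrightarrow> card B = k \<Longrightarrow>
      \<exists>a\<in>A. \<exists>b\<in>B. adj a b"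
  shows "\<exists>vs. distinct vs \<and> set vs \<subseteq> X \<and> successively adj vs \<and> card X + 2 \<le> length vs + 2 * k"
proof -
  obtain S vs T where st: "S \<union> set vs \<union> T = X" "S \<inter> set vs = {}" "S \<inter> T = {}" "set vs \<inter> T = {}"
    "distinct vs" "successively adj vs" "\<forall>w\<in>T. \<forall>s\<in>S. \<not> adj w s" "card S + card X = card T + card X"
    using dfs_state[OF assms(1) order_refl, of adj] by blast
  have fin: "finite S" "finite T" using st(1) assms(1) by (auto intro: finite_subset)
  have "card S < k"
  proof (rule ccontr)
    assume "\<not> card S < k"
    then have "k \<le> card S" "k \<le> card T" using st(8) by auto
    then obtain A B where AB: "A \<subseteq> T" "card A = k" "B \<subseteq> S" "card B = k"
      by (meson obtain_subset_with_card_n)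
    have "\<exists>a\<in>A. \<exists>b\<in>B. adj a b" by (rule assms(2)) (use AB st in auto)
    then show False using AB st(7) by blast
  qed
  moreover have "card X = card S + length vs + card T"
  proof -
    have "card X = card (S \<union> set vs) + card T"
      using st fin by (subst st(1)[symmetric], intro card_Un_disjoint) auto
    also have "card (S \<union> set vs) = card S + card (set vs)"
      using st fin by (intro card_Un_disjoint) auto
    finally show ?thesis using st(5) by (simp add: distinct_card)
  qed
  ultimately have "card X + 2 \<le> length vs + 2 * k" using st(8) by simp
  then show ?thesis using st by (intro exI[of _ vs]) auto
qed

section \<open>Random sequences of vertices\<close>

text \<open>Repetitions are allowed, so the entries behave like independent uniform samples and sums
  over lists can be split off at the first entry. Distinctness is paid for later, through
  \<open>card_distinct_lists_ge\<close>.\<close>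

definition lists_of_length :: "'a set \<Rightarrow> nat \<Rightarrow> 'a list set" where
  "lists_of_length X k = {xs. set xs \<subseteq> X \<and> length xs = k}"

lemma finite_lists_of_length: "finite X \<Longrightarrow> finite (lists_of_length X k)"
  unfolding lists_of_length_def by (rule finite_lists_length_eq)

lemma card_lists_of_length: "finite X \<Longrightarrow> card (lists_of_length X k) = card X ^ k"
  unfolding lists_of_length_def by (rule card_lists_length_eq)

lemma sum_lists_of_length_Suc:
  "(\<Sum>xs\<in>lists_of_length X (Suc k). f xs) = (\<Sum>x\<in>X. \<Sum>xs\<in>lists_of_length X k. f (x # xs))"
proof -
  have *: "lists_of_length X (Suc k) = (\<lambda>(x, xs). x # xs) ` (X \<times> lists_of_length X k)"
    by (auto simp: lists_of_length_def length_Suc_conv image_iff)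
  have "inj_on (\<lambda>(x, xs). x # xs) (X \<times> lists_of_length X k)" by (auto simp: inj_on_def)
  then show ?thesis unfolding * by (simp add: sum.reindex sum.cartesian_product case_prod_unfold)
qed

section \<open>Independent uniform lists without an adjacency between them\<close>

context
  fixes X :: "'a set" and adj :: "'a \<Rightarrow> 'a \<Rightarrow> bool" and a d :: nat
  assumes fin: "finite X" and sym: "\<And>x y. adj x y \<Longrightarrow> adj y x" and irr: "\<And>x. \<not> adj x x"
    and indep: "\<And>I. I \<subseteq> X \<Longrightarrow> (\<forall>x\<in>I. \<forall>y\<in>I. \<not> adj x y) \<Longrightarrow> card I \<le> a"
    and ad: "4 * a * d \<le> card X"
begin

text \<open>Let \<open>L\<close> consist of the vertices outside \<open>W\<close> with fewer than
  \<open>d\<close> neighbours outside \<open>W\<close>. An independent subset \<open>I\<close> of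
  \<open>L\<close> with card L \<le> d * card I shows that \<open>L\<close> has at most a * d
  elements, a quarter of \<open>X\<close>. Outside \<open>W\<close> lies at least half of
  \<open>X\<close>, so at least a quarter remains.\<close>

lemma many_vertices_with_new_neighbours:
  assumes "W \<subseteq> X" "2 * card W \<le> card X"
  shows "card X \<le> 4 * card {x\<in>X. d \<le> card ({y\<in>X. adj x y} - W)}"
proof -
  define U where "U = X - W"
  define L where "L = {x\<in>U. card {y\<in>U. adj x y} < d}"
  have finU: "finite U" using fin by (simp add: U_def)
  have "card {y\<in>L. adj x y} < d" if "x \<in> L" for x
  proof -
    have "card {y\<in>L. adj x y} \<le> card {y\<in>U. adj x y}"
      using finU by (intro card_mono) (auto simp: L_def)
    then show ?thesis using that by (simp add: L_def)
  qed
  then obtain I where I: "I \<subseteq> L" "\<forall>x\<in>I. \<forall>y\<in>I. \<not> adj x y" "card L \<le> d * card I"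
    using independent_subset_of_small_degree[of L adj d] finU sym irr by (auto simp: L_def)
  have "card I \<le> a" using I by (intro indep) (auto simp: L_def U_def)
  then have "d * card I \<le> d * a" by simp
  moreover have "4 * (d * a) \<le> card X" using ad by (simp add: mult.assoc mult.commute[of a])
  ultimately have "4 * card L \<le> card X" using I(3) by linarith
  moreover have "card U = card X - card W" using assms fin by (simp add: U_def card_Diff_subset finite_subset)
  moreover have "card (U - L) = card U - card L"
    using finU by (intro card_Diff_subset) (auto simp: L_def intro: finite_subset)
  moreover have "card (U - L) \<le> card {x\<in>X. d \<le> card ({y\<in>X. adj x y} - W)}"
  proof (rule card_mono)
    have "{y\<in>X. adj x y} - W = {y\<in>U. adj x y}" for x by (auto simp: U_def)
    then show "U - L \<subseteq> {x\<in>X. d \<le> card ({y\<in>X. adj x y} - W)}"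
      by (auto simp: U_def L_def)
  qed (use fin in auto)
  ultimately show ?thesis using assms(2) by linarith
qed

text \<open>Divided by \<open>card X ^ k\<close>, the left side is the expectation of exp(-t m / N),
  where m is the size of the union of \<open>W\<close> with the neighbourhoods of k independent
  uniform vertices. While the union occupies at most half of \<open>X\<close>, the next vertex adds
  \<open>d\<close> elements with probability at least 1/4, which multiplies the expectation by at
  most \<rho>. Once it exceeds half, the term is at most exp(-t/2) whatever follows. The set
  \<open>W\<close> records what has been exposed already.\<close>

lemma sum_exp_neighbourhood_le:
  fixes t :: real
  defines "\<rho> \<equiv> 3 / 4 + exp (- (t / card X) * d) / 4"
  assumes t: "t \<ge> 0" and ne: "X \<noteq> {}" and W: "W \<subseteq> X"
  shows "(\<Sum>xs\<in>lists_of_length X k. exp (- (t / card X) * card (W \<union> (\<Union>x\<in>set xs. {y\<in>X. adj x y}))))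
     \<le> card X ^ k * (exp (- t / 2) + \<rho> ^ k * exp (- (t / card X) * card W))"
  using W
proof (induction k arbitrary: W)
  case 0
  have "lists_of_length X 0 = {[]}" by (auto simp: lists_of_length_def)
  then show ?case by simp
next
  case (Suc k)
  define N where "N = card X"
  have N: "N > 0" using ne fin by (auto simp: N_def card_gt_0_iff)
  define e where "e W = exp (- (t / N) * card W)" for W :: "'a set"
  define nb where "nb x = {y\<in>X. adj x y}" for x
  have e_anti: "e A \<le> e B" if "B \<subseteq> A" "A \<subseteq> X" for A B
  proof -
    have "card B \<le> card A" using that fin finite_subset by (intro card_mono) auto
    then show ?thesis using t N by (simp add: e_def divide_right_mono mult_left_mono)
  qed
  have rho: "0 \<le> \<rho>" by (simp add: \<rho>_def add_nonneg_nonneg)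
  have IH: "(\<Sum>xs\<in>lists_of_length X k. e (V \<union> (\<Union>x\<in>set xs. nb x)))
     \<le> N ^ k * (exp (- t / 2) + \<rho> ^ k * e V)" if "V \<subseteq> X" for V
    using Suc.IH[OF that] by (simp add: e_def N_def nb_def)
  have "(\<Sum>xs\<in>lists_of_length X (Suc k). e (W \<union> (\<Union>x\<in>set xs. nb x)))
     \<le> N ^ Suc k * (exp (- t / 2) + \<rho> ^ Suc k * e W)"
  proof (cases "2 * card W \<le> card X")
    case False
    have "e (W \<union> (\<Union>x\<in>set xs. nb x)) \<le> exp (- t / 2)" for xs
    proof -
      have "e (W \<union> (\<Union>x\<in>set xs. nb x)) \<le> e W"
        using Suc.prems by (intro e_anti) (auto simp: nb_def)
      also have "t * N \<le> t * (2 * card W)"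
        using False t by (intro mult_left_mono) (auto simp: N_def)
      then have "t / 2 \<le> (t / N) * card W" using N by (simp add: field_simps)
      then have "e W \<le> exp (- t / 2)" by (simp add: e_def)
      finally show ?thesis .
    qed
    then have "(\<Sum>xs\<in>lists_of_length X (Suc k). e (W \<union> (\<Union>x\<in>set xs. nb x)))
      \<le> (\<Sum>xs\<in>lists_of_length X (Suc k). exp (- t / 2))" by (intro sum_mono)
    also have "\<dots> = N ^ Suc k * exp (- t / 2)"
      using fin by (simp add: card_lists_of_length N_def)
    also have "\<dots> \<le> N ^ Suc k * (exp (- t / 2) + \<rho> ^ Suc k * e W)"
      using rho by (intro mult_left_mono) (auto simp: e_def)
    finally show ?thesis .
  next
    case True
    define Gd where "Gd = {x\<in>X. d \<le> card (nb x - W)}"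
    define z where "z = exp (- (t / N) * d)"
    have z: "z \<le> 1" using t N by (simp add: z_def)
    have Gd: "real N / 4 \<le> card Gd" and GdX: "Gd \<subseteq> X"
      using many_vertices_with_new_neighbours[OF Suc.prems True]
      by (auto simp: Gd_def nb_def N_def)
    have finW: "finite W" using Suc.prems fin finite_subset by blast
    have egood: "e (W \<union> nb x) \<le> z * e W" if "x \<in> Gd" for x
    proof -
      have "card (W \<union> nb x) = card W + card (nb x - W)"
        using finW fin by (subst Un_Diff_cancel[symmetric], intro card_Un_disjoint) (auto simp: nb_def)
      also have "\<dots> \<ge> card W + d" using that by (simp add: Gd_def)
      finally have "real (card W) + real d \<le> card (W \<union> nb x)" by linarith
      then have "(t / N) * (real (card W) + real d) \<le> (t / N) * card (W \<union> nb x)"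
        using t by (intro mult_left_mono) auto
      then show ?thesis by (simp add: e_def z_def exp_add[symmetric] distrib_left)
    qed
    have eany: "e (W \<union> nb x) \<le> e W" for x
      using Suc.prems by (intro e_anti) (auto simp: nb_def)
    have "(\<Sum>x\<in>X. e (W \<union> nb x)) = (\<Sum>x\<in>X - Gd. e (W \<union> nb x)) + (\<Sum>x\<in>Gd. e (W \<union> nb x))"
      using GdX fin by (rule sum.subset_diff)
    also have "\<dots> \<le> (\<Sum>x\<in>X - Gd. e W) + (\<Sum>x\<in>Gd. z * e W)"
      by (intro add_mono sum_mono eany egood)
    also have "\<dots> = (real N - card Gd * (1 - z)) * e W"
      using GdX fin by (simp add: card_Diff_subset finite_subset N_def card_mono of_nat_diff algebra_simps)
    \<comment> \<open>The left coefficient decreases in \<open>card Gd\<close> and equals N * \<rho>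
      when \<open>card Gd\<close> is exactly N / 4.\<close>
    also have "\<dots> \<le> (N * \<rho>) * e W"
    proof -
      have "real N / 4 * (1 - z) \<le> card Gd * (1 - z)" using Gd z by (intro mult_right_mono) auto
      moreover have "N * \<rho> = N - real N / 4 * (1 - z)"
        by (simp add: \<rho>_def z_def N_def field_simps)
      ultimately have "real N - card Gd * (1 - z) \<le> N * \<rho>" by linarith
      then show ?thesis by (intro mult_right_mono) (auto simp: e_def)
    qed
    finally have sum_e: "(\<Sum>x\<in>X. e (W \<union> nb x)) \<le> N * \<rho> * e W" .
    have "(\<Sum>xs\<in>lists_of_length X (Suc k). e (W \<union> (\<Union>x\<in>set xs. nb x)))
      = (\<Sum>x\<in>X. \<Sum>xs\<in>lists_of_length X k. e ((W \<union> nb x) \<union> (\<Union>x\<in>set xs. nb x)))"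
      by (simp add: sum_lists_of_length_Suc Un_assoc)
    also have "\<dots> \<le> (\<Sum>x\<in>X. N ^ k * (exp (- t / 2) + \<rho> ^ k * e (W \<union> nb x)))"
      using Suc.prems by (intro sum_mono IH) (auto simp: nb_def)
    also have "\<dots> = N ^ k * (N * exp (- t / 2) + \<rho> ^ k * (\<Sum>x\<in>X. e (W \<union> nb x)))"
      by (simp add: sum_distrib_left sum.distrib N_def algebra_simps)
    also have "\<dots> \<le> N ^ k * (N * exp (- t / 2) + \<rho> ^ k * (N * \<rho> * e W))"
      using sum_e rho by (intro mult_left_mono add_left_mono) auto
    also have "\<dots> = N ^ Suc k * (exp (- t / 2) + \<rho> ^ Suc k * e W)"
      by (simp add: algebra_simps)
    finally show ?thesis .
  qed
  then show ?case by (simp add: e_def N_def nb_def)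
qed

text \<open>For fixed \<open>xs\<close> the entries of \<open>ys\<close> must avoid the
  neighbourhood \<open>M xs\<close> of size m, which leaves (N - m)^t choices, at most N^t exp(-t m
  / N). These are the terms of the preceding exponential sum.\<close>

lemma card_nonadjacent_pairs_of_lists_le:
  fixes t :: nat
  defines "\<rho> \<equiv> 3 / 4 + exp (- (real t / card X) * d) / 4"
  assumes ne: "X \<noteq> {}"
  shows "card {(xs, ys). xs \<in> lists_of_length X t \<and> ys \<in> lists_of_length X t \<and>
      (\<forall>x\<in>set xs. \<forall>y\<in>set ys. \<not> adj x y)} \<le> real (card X) ^ (2 * t) * (exp (- real t / 2) + \<rho> ^ t)"
    (is "real (card ?P) \<le> _")
proof -
  define N where "N = card X"
  have N: "N > 0" using ne fin by (auto simp: N_def card_gt_0_iff)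
  \<comment> \<open>Written with \<open>{} \<union>\<close> to match
    \<open>sum_exp_neighbourhood_le\<close> at \<open>W = {}\<close>.\<close>
  define M where "M xs = {} \<union> (\<Union>x\<in>set xs. {y\<in>X. adj x y})" for xs
  have M: "M xs \<subseteq> X" for xs by (auto simp: M_def)
  have "?P = (SIGMA xs:lists_of_length X t. lists_of_length (X - M xs) t)"
    by (auto simp: lists_of_length_def M_def subset_iff)
  then have "real (card ?P) = (\<Sum>xs\<in>lists_of_length X t. real (card (X - M xs) ^ t))"
    using fin by (simp add: card_SigmaI finite_lists_of_length card_lists_of_length)
  also have "\<dots> \<le> (\<Sum>xs\<in>lists_of_length X t. N ^ t * exp (- (real t / N) * card (M xs)))"
  proof (rule sum_mono)
    fix xs
    have c: "card (M xs) \<le> N" using M fin by (simp add: N_def card_mono)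
    have "real (card (X - M xs)) = N * (1 - card (M xs) / N)"
    proof -
      have "card (X - M xs) = N - card (M xs)"
        using M[of xs] fin by (simp add: card_Diff_subset finite_subset N_def)
      then show ?thesis using c N by (simp add: of_nat_diff right_diff_distrib)
    qed
    also have "\<dots> \<le> N * exp (- (card (M xs) / N))"
      using exp_ge_add_one_self[of "- (card (M xs) / N)"] by (intro mult_left_mono) auto
    finally have "real (card (X - M xs)) ^ t \<le> (N * exp (- (card (M xs) / N))) ^ t"
      by (intro power_mono) auto
    also have "\<dots> = N ^ t * exp (- (real t / N) * card (M xs))"
      by (simp add: power_mult_distrib exp_of_nat_mult[symmetric])
    finally show "real (card (X - M xs) ^ t) \<le> N ^ t * exp (- (real t / N) * card (M xs))" by simp
  qed
  also have "\<dots> = N ^ t * (\<Sum>xs\<in>lists_of_length X t. exp (- (real t / N) * card (M xs)))"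
    by (simp add: sum_distrib_left)
  also have "\<dots> \<le> N ^ t * (N ^ t * (exp (- real t / 2) + \<rho> ^ t * exp (- (real t / N) * card ({} :: 'a set))))"
    unfolding \<rho>_def N_def M_def
    by (intro mult_left_mono sum_exp_neighbourhood_le ne) auto
  also have "\<dots> = real N ^ (2 * t) * (exp (- real t / 2) + \<rho> ^ t)"
    by (simp add: power_add mult_2)
  finally show ?thesis by (simp add: N_def)
qed

end

text \<open>The count is a falling factorial whose factors are all at least N - k = N (1 - x) with x
  = k / N. Since x \<le> 1/2, ln (1 - x) \<ge> -x - 2 x^2 \<ge> -2 x, so each factor is at least N
  exp(-2 x).\<close>

lemma card_distinct_lists_ge:
  assumes "finite X" "X \<noteq> {}" "2 * k \<le> card X"
  shows "real (card X) ^ k * exp (- 2 * real k ^ 2 / card X) \<le> card {xs \<in> lists_of_length X k. distinct xs}"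
proof -
  define N where "N = card X"
  have N: "N > 0" using assms by (auto simp: N_def card_gt_0_iff)
  define x where "x = real k / N"
  have x: "0 \<le> x" "x \<le> 1 / 2" using assms N by (auto simp: x_def N_def field_simps)
  have ex: "exp (- 2 * x) \<le> 1 - x"
  proof -
    have "- x - 2 * x\<^sup>2 \<le> ln (1 - x)" using ln_one_minus_pos_lower_bound[of x] x by simp
    moreover have "2 * x\<^sup>2 \<le> x" using x mult_left_mono[of "2 * x" 1 x] by (simp add: power2_eq_square)
    ultimately have "- 2 * x \<le> ln (1 - x)" by simp
    then have "exp (- 2 * x) \<le> exp (ln (1 - x))" by simp
    then show ?thesis using x by simp
  qed
  have "{xs \<in> lists_of_length X k. distinct xs} = {xs. length xs = k \<and> distinct xs \<and> set xs \<subseteq> X}"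
    by (auto simp: lists_of_length_def)
  then have "card {xs \<in> lists_of_length X k. distinct xs} = \<Prod>{N - k + 1..N}"
    using assms by (simp add: card_lists_distinct_length_eq N_def)
  also have "real \<dots> = (\<Prod>i\<in>{N - k + 1..N}. real i)" by simp
  also have "\<dots> \<ge> (\<Prod>i\<in>{N - k + 1..N}. N * exp (- 2 * x))"
  proof (rule prod_mono, intro conjI)
    fix i assume "i \<in> {N - k + 1..N}"
    then have "real N - k \<le> i" by auto
    have "N * exp (- 2 * x) \<le> N * (1 - x)" using ex by (intro mult_left_mono) auto
    also have "\<dots> = real N - k" using N by (simp add: x_def field_simps)
    finally show "N * exp (- 2 * x) \<le> i" using \<open>real N - k \<le> i\<close> by simp
  qed auto
  also have "(\<Prod>i\<in>{N - k + 1..N}. N * exp (- 2 * x)) = (N * exp (- 2 * x)) ^ k"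
    using assms by (simp add: N_def)
  also have "\<dots> = real N ^ k * exp (- 2 * real k ^ 2 / N)"
    by (simp add: power_mult_distrib exp_of_nat_mult[symmetric] x_def power2_eq_square field_simps)
  finally show ?thesis by (simp add: N_def)
qed

section \<open>Permutations and the images of a distinct list\<close>

lemma extend_bij_betw_to_permutes:
  assumes "finite X" "A \<subseteq> X" "bij_betw f A B" "B \<subseteq> X"
  shows "\<exists>\<tau>. \<tau> permutes X \<and> (\<forall>x\<in>A. \<tau> x = f x)"
proof -
  have "card A = card B" using assms(3) by (rule bij_betw_same_card)
  then have "card (X - A) = card (X - B)"
    using assms by (simp add: card_Diff_subset finite_subset)
  then obtain g where g: "bij_betw g (X - A) (X - B)"
    using assms(1) by (meson finite_Diff finite_same_card_bij)
  define \<tau> where "\<tau> x = (if x \<in> A then f x else if x \<in> X then g x else x)" for x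
  have "bij_betw \<tau> A B" using assms(3) by (subst bij_betw_cong[of A \<tau> f]) (auto simp: \<tau>_def)
  moreover have "bij_betw \<tau> (X - A) (X - B)"
    using g by (subst bij_betw_cong[of "X - A" \<tau> g]) (auto simp: \<tau>_def)
  ultimately have "bij_betw \<tau> (A \<union> (X - A)) (B \<union> (X - B))"
    by (rule bij_betw_combine) auto
  moreover have "A \<union> (X - A) = X" "B \<union> (X - B) = X" using assms by auto
  ultimately have "\<tau> permutes X"
    using assms(2) by (intro bij_imp_permutes) (auto simp: \<tau>_def)
  then show ?thesis by (intro exI[of _ \<tau>]) (auto simp: \<tau>_def)
qed

text \<open>Double counting the pairs \<open>(\<pi>, l)\<close> with \<open>map \<pi> l \<in> L\<close>: the number of \<open>\<pi>\<close> for
  a given distinct list \<open>l\<close> does not depend on \<open>l\<close>.\<close>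

lemma card_permutes_map_in:
  assumes fin: "finite X" and ws: "ws \<in> lists_of_length X k" "distinct ws"
    and L: "L \<subseteq> {xs \<in> lists_of_length X k. distinct xs}"
  shows "card {\<pi>. \<pi> permutes X \<and> map \<pi> ws \<in> L} * card {xs \<in> lists_of_length X k. distinct xs}
    = card L * card {\<pi>. \<pi> permutes X}"
proof -
  define D where "D = {xs \<in> lists_of_length X k. distinct xs}"
  define P where "P = {\<pi>. \<pi> permutes X}"
  have finP: "finite P" using fin by (simp add: P_def finite_permutations)
  have finD: "finite D" using fin by (simp add: D_def finite_lists_of_length)
  have same: "card {\<pi>\<in>P. map \<pi> l \<in> L} = card {\<pi>\<in>P. map \<pi> ws \<in> L}" if l: "l \<in> D" for l
  proof -
    have "length ws = length l" "distinct l" "set l \<subseteq> X" "set ws \<subseteq> X"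
      using l ws by (auto simp: D_def lists_of_length_def)
    define f where "f x = the (map_of (zip ws l) x)" for x
    have fi: "f (ws ! i) = l ! i" if "i < length ws" for i
      using that ws \<open>length ws = length l\<close> by (simp add: f_def map_of_zip_nth)
    have mapf: "map f ws = l" using fi \<open>length ws = length l\<close> by (intro nth_equalityI) auto
    then have "bij_betw f (set ws) (set l)"
      using \<open>distinct l\<close> by (metis bij_betw_def distinct_map list.set_map)
    then obtain \<tau> where \<tau>: "\<tau> permutes X" "\<forall>x\<in>set ws. \<tau> x = f x"
      using extend_bij_betw_to_permutes[OF fin \<open>set ws \<subseteq> X\<close>] \<open>set l \<subseteq> X\<close> by blast
    have mapt: "map \<tau> ws = l" using \<tau>(2) mapf by (metis map_cong)
    \<comment> \<open>\<open>\<tau>\<close> sends \<open>ws\<close> to \<open>l\<close>, so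
      \<open>\<pi> \<circ> \<tau>\<close> does to \<open>ws\<close> what \<open>\<pi>\<close> does
      to \<open>l\<close>.\<close>
    have "bij_betw (\<lambda>\<pi>. \<pi> \<circ> \<tau>) {\<pi>\<in>P. map \<pi> l \<in> L} {\<pi>\<in>P. map \<pi> ws \<in> L}"
    proof (rule bij_betwI[where g = "\<lambda>\<pi>. \<pi> \<circ> inv \<tau>"])
      show "(\<lambda>\<pi>. \<pi> \<circ> \<tau>) \<in> {\<pi>\<in>P. map \<pi> l \<in> L} \<rightarrow> {\<pi>\<in>P. map \<pi> ws \<in> L}"
        using \<tau>(1) mapt by (auto simp: P_def permutes_compose simp flip: map_map)
      have "map (inv \<tau>) l = ws"
        using \<tau>(1) unfolding mapt[symmetric] by (simp add: permutes_inv_o)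
      then show "(\<lambda>\<pi>. \<pi> \<circ> inv \<tau>) \<in> {\<pi>\<in>P. map \<pi> ws \<in> L} \<rightarrow> {\<pi>\<in>P. map \<pi> l \<in> L}"
        using \<tau>(1) by (auto simp: P_def permutes_compose permutes_inv simp flip: map_map)
    qed (use \<tau>(1) in \<open>auto simp: o_assoc[symmetric] permutes_inv_o\<close>)
    then show ?thesis by (rule bij_betw_same_card)
  qed
  have perm: "card {l\<in>D. map \<pi> l \<in> L} = card L" if \<pi>: "\<pi> \<in> P" for \<pi>
  proof (rule bij_betw_same_card)
    have p: "\<pi> permutes X" using \<pi> by (simp add: P_def)
    show "bij_betw (map \<pi>) {l\<in>D. map \<pi> l \<in> L} L"
    proof (rule bij_betwI[where g = "map (inv \<pi>)"])
      have inv: "inv \<pi> permutes X" using p by (rule permutes_inv)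
      have "map (inv \<pi>) l \<in> D" if "l \<in> L" for l
      proof -
        have "l \<in> D" using that L by (auto simp: D_def)
        then show ?thesis using inv
          by (auto simp: D_def lists_of_length_def distinct_map permutes_in_image
              intro: inj_on_subset[OF permutes_inj])
      qed
      then show "map (inv \<pi>) \<in> L \<rightarrow> {l\<in>D. map \<pi> l \<in> L}"
        using p by (auto simp: permutes_inv_o)
    qed (use p in \<open>auto simp: permutes_inv_o\<close>)
  qed
  have "card {\<pi>\<in>P. map \<pi> ws \<in> L} * card D = (\<Sum>l\<in>D. card {\<pi>\<in>P. map \<pi> l \<in> L})"
    using same by simp
  also have "\<dots> = (\<Sum>l\<in>D. \<Sum>\<pi>\<in>P. if map \<pi> l \<in> L then 1 else 0)"
    using finP by (intro sum.cong) (simp_all only: card_eq_sum sum.inter_filter)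
  also have "\<dots> = (\<Sum>\<pi>\<in>P. \<Sum>l\<in>D. if map \<pi> l \<in> L then 1 else 0)" by (rule sum.swap)
  also have "\<dots> = (\<Sum>\<pi>\<in>P. card {l\<in>D. map \<pi> l \<in> L})"
    using finD by (intro sum.cong) (simp_all only: card_eq_sum sum.inter_filter)
  also have "\<dots> = card L * card P" using perm by simp
  finally show ?thesis by (simp add: D_def P_def)
qed

section \<open>Consecutive blocks of a path\<close>

definition segment :: "nat \<Rightarrow> 'a list \<Rightarrow> nat \<Rightarrow> 'a list" where
  "segment t vs i = take t (drop (i * t) vs)"

lemma segment_map: "segment t (map f vs) i = map f (segment t vs i)"
  by (simp add: segment_def take_map drop_map)

lemma set_segment_subset: "set (segment t vs i) \<subseteq> set vs"
  unfolding segment_def by (meson set_drop_subset set_take_subset subset_trans)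

lemma length_segment:
  assumes "i < r" "r * t \<le> length vs"
  shows "length (segment t vs i) = t"
proof -
  have "Suc i * t \<le> r * t" using assms(1) by (intro mult_le_mono1) auto
  then show ?thesis using assms(2) by (simp add: segment_def)
qed

lemma distinct_append_segments:
  assumes "distinct vs" "i < j"
  shows "distinct (segment t vs i @ segment t vs j)"
proof -
  have "Suc i * t \<le> j * t" using assms(2) by (intro mult_le_mono1) auto
  then have *: "drop (j * t) vs = drop (j * t - Suc i * t) (drop t (drop (i * t) vs))"
    by (simp add: add.commute)
  have "set (take t (drop (i * t) vs)) \<inter> set (drop t (drop (i * t) vs)) = {}"
    using assms(1) by (intro set_take_disj_set_drop_if_distinct) auto
  moreover have "set (segment t vs j) \<subseteq> set (drop t (drop (i * t) vs))"
    unfolding segment_def * by (meson set_drop_subset set_take_subset subset_trans)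
  ultimately show ?thesis using assms(1)
    by (auto simp: segment_def)
qed

lemma successively_segment:
  assumes "successively P vs"
  shows "successively P (segment t vs i)"
proof -
  have "vs = take (i * t) vs @ segment t vs i @ drop t (drop (i * t) vs)"
    unfolding segment_def by (metis append_take_drop_id)
  then show ?thesis using assms by (metis successively_append_iff)
qed

section \<open>Blocks under a uniformly random permutation\<close>

context
  fixes X :: "'a set" and adj :: "'a \<Rightarrow> 'a \<Rightarrow> bool" and a d :: nat
  assumes fin: "finite X" and sym: "\<And>x y. adj x y \<Longrightarrow> adj y x" and irr: "\<And>x. \<not> adj x x"
    and indep: "\<And>I. I \<subseteq> X \<Longrightarrow> (\<forall>x\<in>I. \<forall>y\<in>I. \<not> adj x y) \<Longrightarrow> card I \<le> a"
    and ad: "4 * a * d \<le> card X"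
begin

text \<open>A uniform permutation maps \<open>as @ bs\<close> to a uniform distinct list of length
  2t. Bad distinct lists are among the bad pairs counted with repetitions, and distinct lists make
  up at least the fraction exp(-8 t^2 / N) of all lists, where 8 t^2 = 2 (2t)^2. Conditioning on
  distinctness therefore costs at most the factor exp(8 t^2 / N).\<close>

lemma card_permutes_nonadjacent_le:
  fixes t :: nat
  defines "\<rho> \<equiv> 3 / 4 + exp (- (real t / card X) * d) / 4"
  assumes ne: "X \<noteq> {}" and t: "4 * t \<le> card X"
    and as: "length as = t" "length bs = t" "distinct (as @ bs)" "set (as @ bs) \<subseteq> X"
  shows "card {\<pi>. \<pi> permutes X \<and> (\<forall>x\<in>set as. \<forall>y\<in>set bs. \<not> adj (\<pi> x) (\<pi> y))}
     \<le> fact (card X) * (exp (8 * real t ^ 2 / card X) * (exp (- real t / 2) + \<rho> ^ t))"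
proof -
  define N where "N = card X"
  have N: "N > 0" using ne fin by (auto simp: N_def card_gt_0_iff)
  define D where "D = {xs \<in> lists_of_length X (2 * t). distinct xs}"
  define L where "L = {xs \<in> D. \<forall>x\<in>set (take t xs). \<forall>y\<in>set (drop t xs). \<not> adj x y}"
  define Q where "Q = {(xs, ys). xs \<in> lists_of_length X t \<and> ys \<in> lists_of_length X t \<and>
      (\<forall>x\<in>set xs. \<forall>y\<in>set ys. \<not> adj x y)}"
  define S where "S = {\<pi>. \<pi> permutes X \<and> map \<pi> (as @ bs) \<in> L}"
  define \<delta> where "\<delta> = exp (- real t / 2) + \<rho> ^ t"
  have finQ: "finite Q"
    by (rule finite_subset[of _ "lists_of_length X t \<times> lists_of_length X t"])
      (auto simp: Q_def intro: finite_lists_of_length fin)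
  have "card L \<le> card Q"
  proof (rule card_inj_on_le)
    show "inj_on (\<lambda>xs. (take t xs, drop t xs)) L"
      by (rule inj_onI) (metis append_take_drop_id prod.inject)
    show "(\<lambda>xs. (take t xs, drop t xs)) ` L \<subseteq> Q"
      by (auto simp: L_def D_def Q_def lists_of_length_def dest: in_set_takeD in_set_dropD)
  qed (rule finQ)
  also have "real (card Q) \<le> real N ^ (2 * t) * \<delta>"
    unfolding Q_def N_def \<delta>_def \<rho>_def
    by (rule card_nonadjacent_pairs_of_lists_le[OF fin sym irr indep ad ne])
  finally have cL: "real (card L) \<le> real N ^ (2 * t) * \<delta>" by simp
  have cD: "real N ^ (2 * t) * exp (- (8 * real t ^ 2 / N)) \<le> card D"
    using card_distinct_lists_ge[of X "2 * t"] fin ne t by (simp add: D_def N_def power_mult_distrib)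
  have "{\<pi>. \<pi> permutes X \<and> (\<forall>x\<in>set as. \<forall>y\<in>set bs. \<not> adj (\<pi> x) (\<pi> y))} = S"
  proof -
    have "map \<pi> (as @ bs) \<in> D" if "\<pi> permutes X" for \<pi>
      unfolding D_def lists_of_length_def mem_Collect_eq set_map distinct_map
      using as that by (auto simp: permutes_in_image intro: inj_on_subset[OF permutes_inj])
    then show ?thesis using as by (auto simp: S_def L_def)
  qed
  moreover have "real (card S) \<le> fact N * (exp (8 * real t ^ 2 / N) * \<delta>)"
  proof -
    have "card S * card D = card L * fact N"
    proof -
      have "L \<subseteq> {xs \<in> lists_of_length X (2 * t). distinct xs}" by (auto simp: L_def D_def)
      moreover have "as @ bs \<in> lists_of_length X (2 * t)" using as by (simp add: lists_of_length_def)
      moreover have "card {\<pi>. \<pi> permutes X} = fact N" using fin by (simp add: card_permutations N_def)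
      ultimately show ?thesis
        using card_permutes_map_in[OF fin, of "as @ bs" "2 * t" L] as(3) unfolding S_def D_def by metis
    qed
    then have "real (card S) * card D = card L * fact N"
      by (metis of_nat_fact of_nat_mult)
    then have "real (card S) * (real N ^ (2 * t) * exp (- (8 * real t ^ 2 / N))) \<le> card L * fact N"
      using mult_left_mono[OF cD, of "card S"] by simp
    also have "\<dots> \<le> (real N ^ (2 * t) * \<delta>) * fact N"
      unfolding of_nat_mult of_nat_fact using cL by (intro mult_right_mono) auto
    finally have "real N ^ (2 * t) * (real (card S) * exp (- (8 * real t ^ 2 / N))) \<le>
        real N ^ (2 * t) * (\<delta> * fact N)" by (simp only: mult_ac)
    then have "real (card S) * exp (- (8 * real t ^ 2 / N)) \<le> \<delta> * fact N"
      using N by (subst (asm) mult_le_cancel_left_pos) auto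
    then show ?thesis by (simp add: exp_minus field_simps)
  qed
  ultimately show ?thesis by (simp add: N_def \<delta>_def)
qed

lemma card_permutes_bad_segments_le:
  fixes t r :: nat
  defines "\<rho> \<equiv> 3 / 4 + exp (- (real t / card X) * d) / 4"
  assumes ne: "X \<noteq> {}" and t: "4 * t \<le> card X"
    and vs: "distinct vs" "set vs \<subseteq> X" "r * t \<le> length vs"
  shows "card {\<pi>. \<pi> permutes X \<and> (\<exists>j<r. \<exists>i<j. \<forall>x\<in>set (segment t vs i). \<forall>y\<in>set (segment t vs j).
       \<not> adj (\<pi> x) (\<pi> y))}
     \<le> fact (card X) * (real r ^ 2 * (exp (8 * real t ^ 2 / card X) * (exp (- real t / 2) + \<rho> ^ t)))"
proof -
  define b where "b = fact (card X) * (exp (8 * real t ^ 2 / card X) * (exp (- real t / 2) + \<rho> ^ t))"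
  define S where "S = (\<lambda>(i, j). {\<pi>. \<pi> permutes X \<and>
      (\<forall>x\<in>set (segment t vs i). \<forall>y\<in>set (segment t vs j). \<not> adj (\<pi> x) (\<pi> y))})"
  define J where "J = {(i, j). i < j \<and> j < r}"
  have JJ: "J \<subseteq> {..<r} \<times> {..<r}" by (auto simp: J_def)
  have finJ: "finite J" using JJ by (rule finite_subset) auto
  have cJ: "card J \<le> r ^ 2"
    using card_mono[OF _ JJ] by (simp add: card_cartesian_product power2_eq_square)
  have b: "real (card (S ij)) \<le> b" if J: "ij \<in> J" for ij
  proof -
    obtain i j where ij: "ij = (i, j)" "i < j" "j < r" using J by (auto simp: J_def)
    have "length (segment t vs i) = t" "length (segment t vs j) = t"
      using ij vs(3) by (auto intro!: length_segment[of _ r])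
    moreover have "set (segment t vs i @ segment t vs j) \<subseteq> X"
      using vs(2) set_segment_subset[of t vs] by auto
    ultimately show ?thesis unfolding b_def \<rho>_def ij S_def prod.case
      by (intro card_permutes_nonadjacent_le[OF ne t] distinct_append_segments vs ij)
  qed
  have b0: "b \<ge> 0" by (simp add: b_def \<rho>_def add_nonneg_nonneg)
  have "{\<pi>. \<pi> permutes X \<and> (\<exists>j<r. \<exists>i<j. \<forall>x\<in>set (segment t vs i). \<forall>y\<in>set (segment t vs j).
       \<not> adj (\<pi> x) (\<pi> y))} = \<Union>(S ` J)" by (auto simp: S_def J_def)
  then have "real (card {\<pi>. \<pi> permutes X \<and> (\<exists>j<r. \<exists>i<j. \<forall>x\<in>set (segment t vs i). \<forall>y\<in>set (segment t vs j).
       \<not> adj (\<pi> x) (\<pi> y))}) \<le> (\<Sum>ij\<in>J. real (card (S ij)))"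
    using card_UN_le[OF finJ, of S] by (simp flip: of_nat_sum)
  also have "\<dots> \<le> (\<Sum>ij\<in>J. b)" by (intro sum_mono b)
  also have "\<dots> = card J * b" by simp
  also have "\<dots> \<le> real r ^ 2 * b"
    using cJ b0 by (intro mult_right_mono) (simp_all flip: of_nat_power)
  finally show ?thesis by (simp add: b_def mult_ac)
qed

end

section \<open>The random graph on the pieces\<close>

abbreviation random_edges :: "'a set \<Rightarrow> real \<Rightarrow> ('a set \<Rightarrow> bool) pmf" where
  "random_edges V p \<equiv> Pi_pmf (all_pairs V) False (\<lambda>_. bernoulli_pmf p)"

text \<open>Here \<open>f\<close> is an edge indicator, so one notion serves both the random graph
  and \<open>G\<close>. The case x = y is not excluded; where this matters, disjointness of
  \<open>A\<close> and \<open>B\<close> is supplied separately.\<close>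

definition joined :: "('a set \<Rightarrow> bool) \<Rightarrow> 'a set \<Rightarrow> 'a set \<Rightarrow> bool" where
  "joined f A B \<longleftrightarrow> (\<exists>x\<in>A. \<exists>y\<in>B. f {x, y})"

lemma finite_all_pairs: "finite V \<Longrightarrow> finite (all_pairs V)"
  by (rule finite_subset[of _ "Pow V"]) (auto simp: all_pairs_def)

lemma prob_no_edge:
  assumes "finite V" "F \<subseteq> all_pairs V" "0 \<le> p" "p \<le> 1"
  shows "measure_pmf.prob (random_edges V p) {f. \<forall>e\<in>F. \<not> f e} = (1 - p) ^ card F"
proof -
  define A where "A = all_pairs V"
  have A: "finite A" "F \<subseteq> A" using assms finite_all_pairs by (auto simp: A_def)
  have "{f. \<forall>e\<in>F. \<not> f e} = Pi A (\<lambda>e. if e \<in> F then {False} else UNIV)"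
    using A by (auto simp: Pi_def)
  then have "measure_pmf.prob (random_edges V p) {f. \<forall>e\<in>F. \<not> f e} =
      (\<Prod>e\<in>A. measure_pmf.prob (bernoulli_pmf p) (if e \<in> F then {False} else UNIV))"
    using A by (simp add: measure_Pi_pmf_Pi A_def)
  also have "\<dots> = (\<Prod>e\<in>A. if e \<in> F then 1 - p else 1)"
    using assms by (intro prod.cong) (auto simp: measure_pmf_single)
  also have "\<dots> = (\<Prod>e\<in>F. 1 - p)"
    using A by (simp add: prod.If_cases Int_absorb1)
  finally show ?thesis by simp
qed

context
  fixes V :: "'a set" and X :: "'a set set" and K :: nat and p :: real
  assumes finV: "finite V" and XV: "\<And>B. B \<in> X \<Longrightarrow> B \<subseteq> V" and cardX: "\<And>B. B \<in> X \<Longrightarrow> card B = K"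
    and disj: "disjoint X" and p: "0 \<le> p" "p \<le> 1"
begin

lemma finite_pieces: "finite X"
  by (rule finite_subset[of _ "Pow V"]) (use XV finV in auto)

lemma card_Union_pieces: "A \<subseteq> X \<Longrightarrow> card (\<Union>A) = card A * K"
proof -
  assume A: "A \<subseteq> X"
  have "card (\<Union>A) = sum card A"
  proof (rule card_Union_disjoint)
    show "pairwise disjnt A" using disj A by (rule pairwise_subset)
    show "finite B" if "B \<in> A" for B using that A XV finV finite_subset by blast
  qed
  also have "\<dots> = card A * K" using A cardX by (simp add: subset_iff)
  finally show ?thesis .
qed

lemma prob_not_joined:
  assumes AB: "\<A> \<subseteq> X" "\<B> \<subseteq> X" "\<A> \<inter> \<B> = {}" "card \<A> = k" "card \<B> = k"
  shows "measure_pmf.prob (random_edges V p) {f. \<forall>A\<in>\<A>. \<forall>B\<in>\<B>. \<not> joined f A B} = (1 - p) ^ ((k * K)\<^sup>2)"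
proof -
  define F where "F = (\<lambda>(x, y). {x, y}) ` (\<Union>\<A> \<times> \<Union>\<B>)"
  have dAB: "\<Union>\<A> \<inter> \<Union>\<B> = {}"
  proof (rule ccontr)
    assume "\<Union>\<A> \<inter> \<Union>\<B> \<noteq> {}"
    then obtain x A B where x: "A \<in> \<A>" "B \<in> \<B>" "x \<in> A" "x \<in> B" by blast
    then have "A \<noteq> B" "A \<in> X" "B \<in> X" using AB by blast+
    then have "A \<inter> B = {}" using disj by (simp add: disjointD)
    then show False using x by blast
  qed
  \<comment> \<open>As the two unions are disjoint, an unordered pair determines which end lies on
    which side, so no pair is counted twice in \<open>F\<close>.\<close>
  have inj: "inj_on (\<lambda>(x, y). {x, y}) (\<Union>\<A> \<times> \<Union>\<B>)"
    using dAB by (auto simp: inj_on_def doubleton_eq_iff)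
  have "card F = (k * K)\<^sup>2"
    unfolding F_def card_image[OF inj]
    using AB by (simp add: card_cartesian_product card_Union_pieces power2_eq_square)
  moreover have "F \<subseteq> all_pairs V"
  proof
    fix e assume "e \<in> F"
    then obtain x y where xy: "e = {x, y}" "x \<in> \<Union>\<A>" "y \<in> \<Union>\<B>" by (auto simp: F_def)
    then have "x \<noteq> y" "x \<in> V" "y \<in> V" using dAB subsetD[OF AB(1)] subsetD[OF AB(2)] XV by blast+
    then show "e \<in> all_pairs V" using xy by (simp add: all_pairs_def)
  qed
  moreover have "{f. \<forall>A\<in>\<A>. \<forall>B\<in>\<B>. \<not> joined f A B} = {f. \<forall>e\<in>F. \<not> f e}"
    by (auto simp: F_def joined_def)
  ultimately show ?thesis using prob_no_edge[OF finV, of F p] p by simp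
qed

text \<open>Union bound over the pairs of families of pieces, at most 2^N * 2^N with N = card X. The
  number \<open>k\<close> is N / 4 rounded up.\<close>

lemma prob_no_long_path_le:
  fixes k :: nat
  defines "k \<equiv> (card X + 3) div 4"
  shows "measure_pmf.prob (random_edges V p)
      {f. \<not> (\<exists>vs. distinct vs \<and> set vs \<subseteq> X \<and> successively (joined f) vs \<and> card X \<le> 2 * length vs)}
    \<le> 4 ^ card X * (1 - p) ^ ((k * K)\<^sup>2)"
proof -
  let ?M = "random_edges V p"
  define J where "J = {(\<A>, \<B>). \<A> \<subseteq> X \<and> \<B> \<subseteq> X \<and> \<A> \<inter> \<B> = {} \<and> card \<A> = k \<and> card \<B> = k}"
  define S where "S = (\<lambda>(\<A>, \<B>). {f. \<forall>A\<in>\<A>. \<forall>B\<in>\<B>. \<not> joined (f :: 'a set \<Rightarrow> bool) A B})"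
  have JJ: "J \<subseteq> Pow X \<times> Pow X" by (auto simp: J_def)
  have finJ: "finite J" using JJ by (rule finite_subset) (simp add: finite_pieces)
  have cJ: "card J \<le> 4 ^ card X"
  proof -
    have "card J \<le> card (Pow X \<times> Pow X)" using JJ by (intro card_mono) (simp_all add: finite_pieces)
    also have "\<dots> = 4 ^ card X"
      using finite_pieces by (simp add: card_cartesian_product card_Pow flip: power_mult_distrib)
    finally show ?thesis .
  qed
  have "{f. \<not> (\<exists>vs. distinct vs \<and> set vs \<subseteq> X \<and> successively (joined f) vs \<and> card X \<le> 2 * length vs)}
      \<subseteq> \<Union>(S ` J)"
  proof (rule subsetI, rule ccontr)
    fix f assume f: "f \<in> {f. \<not> (\<exists>vs. distinct vs \<and> set vs \<subseteq> X \<and> successively (joined f) vs \<and> card X \<le> 2 * length vs)}"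
      and n: "f \<notin> \<Union>(S ` J)"
    have "\<exists>A\<in>\<A>. \<exists>B\<in>\<B>. joined f A B"
      if "\<A> \<subseteq> X" "\<B> \<subseteq> X" "\<A> \<inter> \<B> = {}" "card \<A> = k" "card \<B> = k" for \<A> \<B>
    proof -
      have "(\<A>, \<B>) \<in> J" using that by (simp add: J_def)
      then show ?thesis using n by (auto simp: S_def)
    qed
    from long_path_if_all_large_sets_joined[OF finite_pieces this]
    obtain vs where vs: "distinct vs" "set vs \<subseteq> X" "successively (joined f) vs" "card X + 2 \<le> length vs + 2 * k"
      by blast
    \<comment> \<open>Rounding up costs at most 3, which is covered by twice the summand 2 in the
      path bound.\<close>
    have "4 * k \<le> card X + 3" unfolding k_def by simp
    then have "card X \<le> 2 * length vs" using vs(4) by linarith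
    then show False using f vs by blast
  qed
  then have "measure_pmf.prob ?M
      {f. \<not> (\<exists>vs. distinct vs \<and> set vs \<subseteq> X \<and> successively (joined f) vs \<and> card X \<le> 2 * length vs)}
    \<le> measure_pmf.prob ?M (\<Union>(S ` J))" by (intro measure_pmf.finite_measure_mono) auto
  also have "\<dots> \<le> (\<Sum>j\<in>J. measure_pmf.prob ?M (S j))"
    using finJ by (intro measure_pmf.finite_measure_subadditive_finite) auto
  also have "\<dots> = (\<Sum>j\<in>J. (1 - p) ^ ((k * K)\<^sup>2))"
    by (intro sum.cong refl) (auto simp: S_def J_def prob_not_joined)
  also have "\<dots> = card J * (1 - p) ^ ((k * K)\<^sup>2)" by simp
  also have "\<dots> \<le> 4 ^ card X * (1 - p) ^ ((k * K)\<^sup>2)"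
  proof (rule mult_right_mono)
    have "real (card J) \<le> real (4 ^ card X)" using cJ by (simp only: of_nat_le_iff)
    then show "real (card J) \<le> 4 ^ card X" by simp
  qed (use p in auto)
  finally show ?thesis .
qed

text \<open>This is where equal sizes matter: each piece \<open>B\<close> has a bijection onto
  \<open>\<pi> B\<close>. Disjointness lets these be glued, and the result extends to
  \<open>V\<close>.\<close>

lemma ex_permutes_lifting:
  assumes "\<pi> permutes X"
  shows "\<exists>\<sigma>. \<sigma> permutes V \<and> (\<forall>B\<in>X. \<sigma> ` B = \<pi> B)"
proof -
  have "\<exists>g. bij_betw g B (\<pi> B)" if "B \<in> X" for B
  proof -
    have "\<pi> B \<in> X" using assms that by (simp add: permutes_in_image)
    then have "card B = card (\<pi> B)" "finite B" "finite (\<pi> B)"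
      using cardX that finite_subset[OF XV finV] by auto
    then show ?thesis by (intro finite_same_card_bij)
  qed
  then obtain g where g: "\<And>B. B \<in> X \<Longrightarrow> bij_betw (g B) B (\<pi> B)" by metis
  define h where "h x = g (THE B. B \<in> X \<and> x \<in> B) x" for x
  have h: "h x = g B x" if "x \<in> B" "B \<in> X" for x B
  proof -
    have "(THE B. B \<in> X \<and> x \<in> B) = B"
    proof (rule the_equality)
      fix A assume A: "A \<in> X \<and> x \<in> A"
      show "A = B"
      proof (rule ccontr)
        assume "A \<noteq> B"
        then have "A \<inter> B = {}" using A that disj by (simp add: disjointD)
        then show False using A that by blast
      qed
    qed (use that in blast)
    then show ?thesis by (simp add: h_def)
  qed
  have hB: "bij_betw h B (\<pi> B)" if "B \<in> X" for B
    using g[OF that] h that by (subst bij_betw_cong[of B h "g B"]) auto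
  have "bij_betw h (\<Union>B\<in>X. B) (\<Union>B\<in>X. \<pi> B)"
  proof (rule bij_betw_UNION_disjoint)
    show "disjoint_family_on \<pi> X"
      unfolding disjoint_family_on_def
    proof (intro ballI impI)
      fix A B assume "A \<in> X" "B \<in> X" "A \<noteq> B"
      then have "\<pi> A \<in> X" "\<pi> B \<in> X" "\<pi> A \<noteq> \<pi> B"
        using assms by (auto simp: permutes_in_image inj_eq[OF permutes_inj])
      then show "\<pi> A \<inter> \<pi> B = {}" using disj by (simp add: disjointD)
    qed
  qed (rule hB)
  moreover have "(\<Union>B\<in>X. \<pi> B) = \<Union>X" using permutes_image[OF assms] by auto
  ultimately have "bij_betw h (\<Union>X) (\<Union>X)" by simp
  then obtain \<sigma> where \<sigma>: "\<sigma> permutes V" "\<forall>x\<in>\<Union>X. \<sigma> x = h x"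
    using extend_bij_betw_to_permutes[OF finV, of "\<Union>X" h "\<Union>X"] XV by blast
  have "\<sigma> ` B = \<pi> B" if "B \<in> X" for B
  proof -
    have "\<sigma> ` B = h ` B" using \<sigma>(2) that by (intro image_cong) auto
    then show ?thesis using hB[OF that] by (simp add: bij_betw_def)
  qed
  then show ?thesis using \<sigma>(1) by blast
qed

end

text \<open>A vertex permutation permutes the pairs, whose indicators are independent with equal
  law. This symmetry is what makes the position of the path random.\<close>

lemma random_edges_permutes:
  assumes "finite V" "\<sigma> permutes V"
  shows "map_pmf (\<lambda>f. f \<circ> (`) \<sigma>) (random_edges V p) = random_edges V p"
proof (rule Pi_pmf_bij_betw[symmetric])
  have iff: "\<sigma> ` e \<in> all_pairs V \<longleftrightarrow> e \<in> all_pairs V" for e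
  proof -
    have "card (\<sigma> ` e) = card e"
      using permutes_inj[OF assms(2)] by (intro card_image) (rule inj_on_subset, auto)
    moreover have "\<sigma> ` e \<subseteq> V \<longleftrightarrow> e \<subseteq> V"
      using permutes_in_image[OF assms(2)] by blast
    ultimately show ?thesis by (simp add: all_pairs_def)
  qed
  show "bij_betw ((`) \<sigma>) (all_pairs V) (all_pairs V)"
  proof (rule bij_betwI[where g = "(`) (inv \<sigma>)"])
    show "(`) (inv \<sigma>) \<in> all_pairs V \<rightarrow> all_pairs V"
    proof
      fix e assume "e \<in> all_pairs V"
      moreover have "\<sigma> ` (inv \<sigma> ` e) = e"
        using assms(2) by (simp add: image_image permutes_inverses)
      ultimately show "inv \<sigma> ` e \<in> all_pairs V" using iff[of "inv \<sigma> ` e"] by simp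
    qed
  qed (use assms(2) iff in \<open>auto simp: image_image permutes_inverses\<close>)
  show "\<sigma> ` e \<notin> all_pairs V" if "e \<notin> all_pairs V" for e using that iff by blast
qed (use assms finite_all_pairs in auto)

lemma joined_comp_image: "joined (f \<circ> (`) \<sigma>) A B \<longleftrightarrow> joined f (\<sigma> ` A) (\<sigma> ` B)"
  by (simp add: joined_def)

section \<open>Placing the path at random\<close>

text \<open>Choose one representative per piece: an edge between two representatives would join
  their pieces. Thus the graph on the pieces inherits the bound on independent sets from
  \<open>G\<close>.\<close>

lemma independent_pieces_le:
  assumes G: "simple_graph G" and XV: "\<And>B. B \<in> I \<Longrightarrow> B \<subseteq> verts G \<and> B \<noteq> {}" and disj: "disjoint I"
    and ind: "\<And>A B. A \<in> I \<Longrightarrow> B \<in> I \<Longrightarrow> A \<noteq> B \<Longrightarrow> \<not> joined (\<lambda>e. e \<in> edges G) A B"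
  shows "card I \<le> independence_number G"
proof -
  obtain rep where rep: "\<And>B. B \<in> I \<Longrightarrow> rep B \<in> B"
    using XV by (metis ex_in_conv)
  have inj: "inj_on rep I"
  proof (rule inj_onI, rule ccontr)
    fix A B assume AB: "A \<in> I" "B \<in> I" "rep A = rep B" "A \<noteq> B"
    then have "A \<inter> B = {}" using disj by (simp add: disjointD)
    then show False using rep AB by (metis disjoint_iff)
  qed
  have "independent_set G (rep ` I)"
    unfolding independent_set_def
  proof (intro conjI ballI notI)
    show "rep ` I \<subseteq> verts G" using rep XV by blast
    fix e assume e: "e \<in> edges G" "e \<subseteq> rep ` I"
    then have "card e = 2" using G by (auto simp: simple_graph_def all_pairs_def)
    then obtain x y where xy: "e = {x, y}" "x \<noteq> y" by (auto simp: card_2_iff)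
    then obtain A B where AB: "A \<in> I" "B \<in> I" "x = rep A" "y = rep B" using e by auto
    then have "A \<noteq> B" using xy by auto
    moreover have "joined (\<lambda>e. e \<in> edges G) A B"
      using e xy AB rep unfolding joined_def by blast
    ultimately show False using ind AB by blast
  qed
  from card_le_independence_number[OF G this] show ?thesis by (simp add: card_image inj)
qed

text \<open>\<open>G\<close> connects each piece internally and joins different segments, while the
  random edges link consecutive pieces of one segment. Pieces beyond the first r segments are
  dropped.\<close>

lemma complete_minor_of_path_of_pieces:
  assumes G: "simple_graph G"
    and X: "\<And>B. B \<in> X \<Longrightarrow> B \<subseteq> verts G \<and> B \<noteq> {} \<and> cut_connected (edges G) B" and disj: "disjoint X"
    and vs: "distinct vs" "set vs \<subseteq> X" "successively (joined f) vs" "r * t \<le> length vs" and t: "t > 0"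
    and adj: "\<And>i j. i < j \<Longrightarrow> j < r \<Longrightarrow>
      \<exists>A\<in>set (segment t vs i). \<exists>B\<in>set (segment t vs j). joined (\<lambda>e. e \<in> edges G) A B"
  shows "is_minor (complete_graph r)
    (graph_union G \<lparr>verts = verts G, edges = {e \<in> all_pairs (verts G). f e}\<rparr>)" (is "is_minor _ ?H")
proof -
  let ?B = "\<lambda>i. \<Union>(set (segment t vs i))"
  have vH: "verts ?H = verts G" by (simp add: graph_union_def)
  have eH: "edges ?H = edges G \<union> {e \<in> all_pairs (verts G). f e}" by (simp add: graph_union_def)
  have sub: "set (segment t vs i) \<subseteq> X" for i
    by (rule subset_trans[OF set_segment_subset vs(2)])
  have ne: "segment t vs i \<noteq> []" if "i < r" for i
    using length_segment[OF that vs(4)] t by auto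
  have dseg: "set (segment t vs i) \<inter> set (segment t vs j) = {}" if "i \<noteq> j" for i j
    using distinct_append_segments[OF vs(1), of i j t] distinct_append_segments[OF vs(1), of j i t] that
    by (cases i j rule: linorder_cases) auto
  show ?thesis
  proof (rule complete_minor_of_branch_sets[where B = ?B])
    show "simple_graph ?H"
      using G unfolding simple_graph_def vH eH by auto
    show "?B i \<subseteq> verts ?H" if "i < r" for i
      unfolding vH using sub X by blast
    show "?B i \<noteq> {}" if "i < r" for i
    proof -
      obtain A where "A \<in> set (segment t vs i)" using ne[OF \<open>i < r\<close>] by (metis list.set_sel(1))
      then show ?thesis using sub X by blast
    qed
    show "disjoint_family_on ?B {..<r}"
      unfolding disjoint_family_on_def
    proof (intro ballI impI, rule ccontr)
      fix i j assume ij: "i \<noteq> j" "?B i \<inter> ?B j \<noteq> {}"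
      then obtain x A B where x: "A \<in> set (segment t vs i)" "B \<in> set (segment t vs j)" "x \<in> A" "x \<in> B"
        by blast
      then have "A \<noteq> B" using dseg[OF ij(1)] by blast
      moreover have "A \<in> X" "B \<in> X" using x sub by blast+
      ultimately have "A \<inter> B = {}" using disj by (simp add: disjointD)
      then show False using x by blast
    qed
    show "\<exists>x\<in>?B i. \<exists>y\<in>?B j. {x, y} \<in> edges ?H" if "i < j" "j < r" for i j
    proof -
      obtain A B x y where "A \<in> set (segment t vs i)" "B \<in> set (segment t vs j)" "x \<in> A" "y \<in> B"
        "{x, y} \<in> edges G" using adj[OF \<open>i < j\<close> \<open>j < r\<close>] unfolding joined_def by (elim bexE)
      moreover from this(5) have "{x, y} \<in> edges ?H" by (simp add: eH)
      ultimately show ?thesis by (meson UnionI)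
    qed
    show "cut_connected (edges ?H) (?B i)" if "i < r" for i
    proof (rule cut_connected_Union_path[where vs = "segment t vs i"])
      show "segment t vs i \<noteq> []" by (rule ne[OF that])
      show "cut_connected (edges ?H) A" if "A \<in> set (segment t vs i)" for A
      proof -
        have "A \<in> X" using that sub[of i] by (rule subsetD[rotated])
        then have "cut_connected (edges G) A" using X by simp
        then show ?thesis by (rule cut_connected_mono) (simp add: eH)
      qed
      \<comment> \<open>For a common vertex x, \<open>joined\<close> could be witnessed by the value
        of \<open>f\<close> at {x}; disjointness ensures that the witness is a genuine pair.\<close>
      have "successively (\<lambda>A B. joined f A B \<and> A \<inter> B = {}) vs"
      proof -
        have "successively (\<lambda>A B. A \<inter> B = {}) vs"
        proof (rule successively_if_sorted_wrt, subst sorted_wrt_iff_nth_less, intro allI impI)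
          fix i j assume "i < j" "j < length vs"
          then have "vs ! i \<noteq> vs ! j" "vs ! i \<in> X" "vs ! j \<in> X"
            using vs by (auto simp: nth_eq_iff_index_eq)
          then show "vs ! i \<inter> vs ! j = {}" using disj by (simp add: disjointD)
        qed
        then show ?thesis using vs(3) by (simp add: successively_conv_nth)
      qed
      then have "successively (\<lambda>A B. joined f A B \<and> A \<inter> B = {}) (segment t vs i)"
        by (rule successively_segment)
      then show "successively (\<lambda>A B. \<exists>a\<in>A. \<exists>b\<in>B. {a, b} \<in> edges ?H) (segment t vs i)"
      proof (rule successively_mono)
        fix A B assume AB: "A \<in> set (segment t vs i)" "B \<in> set (segment t vs i)" "joined f A B \<and> A \<inter> B = {}"
        then obtain a b where ab: "a \<in> A" "b \<in> B" "f {a, b}" by (auto simp: joined_def)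
        moreover have "a \<noteq> b" using ab AB by blast
        moreover have "a \<in> verts G" "b \<in> verts G" using ab AB sub X by blast+
        ultimately have "{a, b} \<in> edges ?H" unfolding eH by (simp add: all_pairs_def)
        then show "\<exists>a\<in>A. \<exists>b\<in>B. {a, b} \<in> edges ?H" using ab by blast
      qed
    qed
  qed
qed

text \<open>The law of the random edges is invariant under permuting the pieces.  Averaging over all
  permutations turns the path given by the random graph into a random sequence of pieces.\<close>

lemma prob_complete_minor_ge:
  fixes G :: "'a graph" and p :: real and K t r d :: nat
  assumes G: "simple_graph G"
    and X: "\<And>B. B \<in> X \<Longrightarrow> B \<subseteq> verts G \<and> card B = K \<and> cut_connected (edges G) B" and disj: "disjoint X"
    and K: "K > 0" and p: "0 \<le> p" "p \<le> 1" and ne: "X \<noteq> {}"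
    and t: "t > 0" "4 * t \<le> card X" and r: "2 * (r * t) \<le> card X"
    and ad: "4 * independence_number G * d \<le> card X"
  shows "1 - (4 ^ card X * (1 - p) ^ (((card X + 3) div 4 * K)\<^sup>2) + real r ^ 2 *
      (exp (8 * real t ^ 2 / card X) * (exp (- real t / 2) + (3 / 4 + exp (- (real t / card X) * d) / 4) ^ t)))
    \<le> measure_pmf.prob (binomial_random_graph (verts G) p)
        {R. is_minor (complete_graph r) (graph_union G R)}"
proof -
  define V where "V = verts G"
  define M where "M = random_edges V p"
  define N where "N = card X"
  define \<delta> where "\<delta> = real r ^ 2 *
      (exp (8 * real t ^ 2 / N) * (exp (- real t / 2) + (3 / 4 + exp (- (real t / N) * d) / 4) ^ t))"
  define \<eta> where "\<eta> = 4 ^ N * (1 - p) ^ (((N + 3) div 4 * K)\<^sup>2)"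
  define good where "good f = is_minor (complete_graph r)
    (graph_union G \<lparr>verts = V, edges = {e \<in> all_pairs V. f e}\<rparr>)" for f
  define Path where "Path f vs \<longleftrightarrow> distinct vs \<and> set vs \<subseteq> X \<and> successively (joined f) vs \<and> N \<le> 2 * length vs"
    for f vs
  define P where "P = {\<pi>. \<pi> permutes X}"
  \<comment> \<open>A piece is joined to itself by its own edges, so \<open>A \<noteq> B\<close> is
    built in to make \<open>adj\<close> irreflexive.\<close>
  define adj where "adj A B \<longleftrightarrow> A \<noteq> B \<and> joined (\<lambda>e. e \<in> edges G) A B" for A B
  have finV: "finite V" using G by (simp add: V_def simple_graph_def)
  have XV: "B \<subseteq> V" "card B = K" if "B \<in> X" for B using X that by (auto simp: V_def)
  have Xne: "B \<noteq> {}" if "B \<in> X" for B using XV(2)[OF that] K by auto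
  have finX: "finite X" by (rule finite_subset[of _ "Pow V"]) (use XV finV in auto)
  have finP: "finite P" and cP: "card P = fact N"
    using finX by (simp_all add: P_def finite_permutations card_permutations N_def)
  have sym: "adj B A" if "adj A B" for A B
    using that unfolding adj_def joined_def by (metis insert_commute)
  have irr: "\<not> adj A A" for A by (simp add: adj_def)
  have indep: "card I \<le> independence_number G" if "I \<subseteq> X" "\<forall>x\<in>I. \<forall>y\<in>I. \<not> adj x y" for I
  proof (rule independent_pieces_le[OF G])
    show "disjoint I" using disj that(1) by (rule pairwise_subset)
    show "B \<subseteq> verts G \<and> B \<noteq> {}" if "B \<in> I" for B using that \<open>I \<subseteq> X\<close> X Xne by blast
  qed (use that in \<open>auto simp: adj_def\<close>)
  \<comment> \<open>Composing \<open>f\<close> with the image map of \<open>\<sigma> \<pi>\<close>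
    pulls edges back. Lifting \<open>inv \<pi>\<close> is therefore what moves a path
    \<open>vs\<close> of \<open>f\<close> to the path \<open>map \<pi> vs\<close>.\<close>
  have "\<exists>\<sigma>. \<sigma> permutes V \<and> (\<forall>B\<in>X. \<sigma> ` B = inv \<pi> B)" if "\<pi> \<in> P" for \<pi>
    by (rule ex_permutes_lifting[OF finV XV disj p]) (use that permutes_inv in \<open>auto simp: P_def\<close>)
  then obtain \<sigma> where \<sigma>: "\<And>\<pi>. \<pi> \<in> P \<Longrightarrow> \<sigma> \<pi> permutes V"
    "\<And>\<pi> B. \<pi> \<in> P \<Longrightarrow> B \<in> X \<Longrightarrow> \<sigma> \<pi> ` B = inv \<pi> B" by metis
  define bad where "bad \<pi> = {f. \<not> good (f \<circ> (`) (\<sigma> \<pi>))}" for \<pi>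
  have good_if_path: "good f" if "Path f vs"
    and "\<And>i j. i < j \<Longrightarrow> j < r \<Longrightarrow> \<exists>A\<in>set (segment t vs i). \<exists>B\<in>set (segment t vs j). adj A B" for f vs
    unfolding good_def V_def
  proof (rule complete_minor_of_path_of_pieces[OF G _ disj, where vs = vs and t = t])
    show "r * t \<le> length vs" using that(1) r by (simp add: Path_def N_def)
    show "\<exists>A\<in>set (segment t vs i). \<exists>B\<in>set (segment t vs j). joined (\<lambda>e. e \<in> edges G) A B"
      if "i < j" "j < r" for i j
      using \<open>\<And>i j. i < j \<Longrightarrow> j < r \<Longrightarrow> _\<close>[OF that] unfolding adj_def by blast
  qed (use that X Xne t in \<open>auto simp: Path_def\<close>)
  have path_perm: "Path (f \<circ> (`) (\<sigma> \<pi>)) (map \<pi> vs)" if "Path f vs" "\<pi> \<in> P" for f vs \<pi>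
  proof -
    have \<pi>: "\<pi> permutes X" using that by (simp add: P_def)
    have "joined (f \<circ> (`) (\<sigma> \<pi>)) (\<pi> A) (\<pi> B) = joined f A B" if "A \<in> X" "B \<in> X" for A B
    proof -
      have "\<pi> A \<in> X" "\<pi> B \<in> X" using that \<pi> by (simp_all add: permutes_in_image)
      then show ?thesis
        using \<sigma>(2)[OF \<open>\<pi> \<in> P\<close>] \<pi> by (simp add: joined_comp_image permutes_inverses)
    qed
    then have "successively (joined (f \<circ> (`) (\<sigma> \<pi>))) (map \<pi> vs)"
      using \<open>Path f vs\<close> unfolding Path_def successively_map
      by (metis (no_types, lifting) subsetD successively_cong)
    moreover have "distinct (map \<pi> vs)"
      using \<open>Path f vs\<close> \<pi> by (auto simp: Path_def distinct_map intro: inj_on_subset[OF permutes_inj])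
    moreover have "set (map \<pi> vs) \<subseteq> X"
      using \<open>Path f vs\<close> \<pi> by (auto simp: Path_def permutes_in_image)
    ultimately show ?thesis using \<open>Path f vs\<close> by (simp add: Path_def)
  qed
  \<comment> \<open>Pointwise in \<open>f\<close>: a path of \<open>f\<close> is fixed first and
    only \<open>\<pi>\<close> varies, so the permutation count applies. Without a path, all N!
    permutations are charged to the indicator.\<close>
  have count: "real (card {\<pi>\<in>P. f \<in> bad \<pi>}) \<le> fact N * (indicator {f. \<not> (\<exists>vs. Path f vs)} f + \<delta>)" for f
  proof (cases "\<exists>vs. Path f vs")
    case True
    then obtain vs where vs: "Path f vs" by blast
    define S where "S = {\<pi>. \<pi> permutes X \<and> (\<exists>j<r. \<exists>i<j. \<forall>x\<in>set (segment t vs i). \<forall>y\<in>set (segment t vs j).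
       \<not> adj (\<pi> x) (\<pi> y))}"
    have "{\<pi>\<in>P. f \<in> bad \<pi>} \<subseteq> S"
    proof (rule subsetI, rule ccontr)
      fix \<pi> assume \<pi>: "\<pi> \<in> {\<pi>\<in>P. f \<in> bad \<pi>}" "\<pi> \<notin> S"
      then have "\<exists>x\<in>set (segment t vs i). \<exists>y\<in>set (segment t vs j). adj (\<pi> x) (\<pi> y)"
        if "i < j" "j < r" for i j using that by (auto simp: S_def P_def)
      then have "\<exists>A\<in>set (segment t (map \<pi> vs) i). \<exists>B\<in>set (segment t (map \<pi> vs) j). adj A B"
        if "i < j" "j < r" for i j using that unfolding segment_map by fastforce
      moreover have "Path (f \<circ> (`) (\<sigma> \<pi>)) (map \<pi> vs)" using \<pi> vs by (intro path_perm) auto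
      ultimately have "good (f \<circ> (`) (\<sigma> \<pi>))" by (intro good_if_path) auto
      then show False using \<pi>(1) by (simp add: bad_def)
    qed
    moreover have "finite S" using finX by (simp add: S_def finite_permutations)
    ultimately have "real (card {\<pi>\<in>P. f \<in> bad \<pi>}) \<le> card S" by (simp add: card_mono)
    also have "\<dots> \<le> fact N * \<delta>"
      unfolding S_def N_def \<delta>_def
    proof (rule card_permutes_bad_segments_le[OF finX sym irr indep ad ne t(2)])
      show "r * t \<le> length vs" using vs r by (simp add: Path_def N_def)
    qed (use vs in \<open>auto simp: Path_def\<close>)
    finally show ?thesis using True by simp
  next
    case False
    have "card {\<pi>\<in>P. f \<in> bad \<pi>} \<le> card P" using finP by (intro card_mono) auto
    then have "real (card {\<pi>\<in>P. f \<in> bad \<pi>}) \<le> fact N" by (simp add: cP flip: of_nat_le_iff[where 'a = real])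
    moreover have "\<delta> \<ge> 0" by (simp add: \<delta>_def add_nonneg_nonneg)
    ultimately show ?thesis using False by (simp add: distrib_left add_increasing2)
  qed
  have same: "measure_pmf.prob M (bad \<pi>) = measure_pmf.prob M {f. \<not> good f}" if "\<pi> \<in> P" for \<pi>
  proof -
    have "measure_pmf.prob M {f. \<not> good f} =
        measure_pmf.prob (map_pmf (\<lambda>f. f \<circ> (`) (\<sigma> \<pi>)) M) {f. \<not> good f}"
      unfolding M_def using random_edges_permutes[OF finV \<sigma>(1)[OF that]] by simp
    then show ?thesis by (simp add: bad_def vimage_def)
  qed
  \<comment> \<open>By invariance every \<open>bad \<pi>\<close> has the same probability, so N!
    times it is the expected number of bad permutations, to which the pointwise bound
    applies.\<close>
  have "fact N * measure_pmf.prob M {f. \<not> good f} = (\<Sum>\<pi>\<in>P. measure_pmf.prob M (bad \<pi>))"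
    using same by (simp add: cP)
  also have "\<dots> = measure_pmf.expectation M (\<lambda>f. \<Sum>\<pi>\<in>P. indicator (bad \<pi>) f)"
    by (simp add: measure_pmf.emeasure_eq_measure)
  also have "\<dots> = measure_pmf.expectation M (\<lambda>f. real (card {\<pi>\<in>P. f \<in> bad \<pi>}))"
    using finP by (intro Bochner_Integration.integral_cong refl)
      (simp add: indicator_def sum.If_cases Int_def)
  also have "\<dots> \<le> measure_pmf.expectation M (\<lambda>f. fact N * (indicator {f. \<not> (\<exists>vs. Path f vs)} f + \<delta>))"
  proof (rule integral_mono)
    show "integrable (measure_pmf M) (\<lambda>f. real (card {\<pi>\<in>P. f \<in> bad \<pi>}))"
      using finP by (intro measure_pmf.integrable_const_bound[where B = "card P"])
        (auto intro!: card_mono)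
    show "integrable (measure_pmf M) (\<lambda>f. fact N * (indicator {f. \<not> (\<exists>vs. Path f vs)} f + \<delta>))"
      by (simp add: measure_pmf.emeasure_eq_measure)
  qed (rule count)
  also have "\<dots> = fact N * (measure_pmf.prob M {f. \<not> (\<exists>vs. Path f vs)} + \<delta>)"
    by (simp add: measure_pmf.emeasure_eq_measure)
  finally have "measure_pmf.prob M {f. \<not> good f} \<le> measure_pmf.prob M {f. \<not> (\<exists>vs. Path f vs)} + \<delta>"
    by (subst (asm) mult_le_cancel_left_pos) auto
  also have "measure_pmf.prob M {f. \<not> (\<exists>vs. Path f vs)} \<le> \<eta>"
    unfolding M_def Path_def \<eta>_def N_def by (rule prob_no_long_path_le[OF finV XV disj p])
  finally have "measure_pmf.prob M {f. \<not> good f} \<le> \<eta> + \<delta>" by simp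
  moreover have "measure_pmf.prob M {f. good f} = 1 - measure_pmf.prob M {f. \<not> good f}"
    using measure_pmf.prob_compl[of "{f. \<not> good f}" M] by (simp add: Compl_eq_Diff_UNIV[symmetric] Collect_neg_eq[symmetric])
  moreover have "measure_pmf.prob (binomial_random_graph (verts G) p)
        {R. is_minor (complete_graph r) (graph_union G R)} = measure_pmf.prob M {f. good f}"
    by (simp add: binomial_random_graph_def good_def M_def V_def vimage_def)
  ultimately show ?thesis by (simp add: \<eta>_def \<delta>_def N_def)
qed

section \<open>Estimates\<close>

text \<open>The rounding in N div (4 a) loses at most a factor 2, so the inner exponent is at least
  y = t / (8 a) in absolute value. If y \<le> 1, then \<rho> \<le> 1 - y / 8 and \<rho>^t is at most
  exp(-t^2 / (64 a)). If y > 1, then \<rho> \<le> 7/8 and \<rho>^t is at most exp(-t / 8). The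
  correction exp(8 t^2 / N) consumes at most half of either exponent, as 128 t \<le> N bounds 8 t^2
  / N by t / 16 and 1024 a \<le> N bounds it by t^2 / (128 a).\<close>

lemma nonadjacency_bound:
  fixes a N t :: nat
  assumes a: "a \<ge> 1" "1024 * a \<le> N" and t: "128 * t \<le> N"
  shows "exp (8 * real t ^ 2 / N) *
      (exp (- real t / 2) + (3 / 4 + exp (- (real t / N) * (N div (4 * a))) / 4) ^ t)
    \<le> 2 * exp (- real t / 16) + exp (- (real t ^ 2 / (128 * real a)))"
proof -
  define \<rho> where "\<rho> = 3 / 4 + exp (- (real t / N) * (N div (4 * a))) / 4"
  define y where "y = real t / (8 * a)"
  have N: "N > 0" using a by simp
  have y0: "0 \<le> y" by (simp add: y_def)
  have "N < 4 * a * (N div (4 * a)) + 4 * a"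
    using dividend_less_times_div[of "4 * a" N] a(1) by simp
  then have "N \<le> 8 * a * (N div (4 * a))" using a(2) by linarith
  then have "real N \<le> 8 * a * (N div (4 * a))" by (metis of_nat_le_iff of_nat_mult of_nat_numeral)
  then have "real t * real N \<le> real t * real (8 * a * (N div (4 * a)))" by (intro mult_left_mono) auto
  then have "y \<le> (real t / N) * (N div (4 * a))"
    using N a(1) by (simp add: y_def field_simps)
  then have rho: "\<rho> \<le> 3 / 4 + exp (- y) / 4" by (simp add: \<rho>_def)
  have rho0: "0 \<le> \<rho>" by (simp add: \<rho>_def add_nonneg_nonneg)
  have ey: "exp (- y) \<le> 1 / (1 + y)"
    using exp_ge_add_one_self[of y] y0 by (simp add: exp_minus field_simps)
  have pow: "\<rho> ^ t \<le> exp (- real t / 8) + exp (- (real t ^ 2 / (64 * real a)))"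
  proof (cases "y \<le> 1")
    case True
    have "1 / (1 + y) \<le> 1 - y / 2"
      using y0 True mult_left_mono[of y 1 y] by (simp add: field_simps)
    then have "\<rho> \<le> 1 - y / 8" using rho ey by linarith
    also have "\<dots> \<le> exp (- (y / 8))" using exp_ge_add_one_self[of "- (y / 8)"] by simp
    finally have "\<rho> ^ t \<le> exp (- (y / 8)) ^ t" using rho0 by (intro power_mono)
    also have "\<dots> = exp (- (real t ^ 2 / (64 * real a)))"
      by (simp add: exp_of_nat_mult[symmetric] y_def power2_eq_square)
    finally show ?thesis by (simp add: add_increasing)
  next
    case False
    then have "1 / (1 + y) \<le> 1 / 2" by (simp add: field_simps)
    then have "\<rho> \<le> 7 / 8" using rho ey by linarith
    also have "\<dots> \<le> exp (- (1 / 8))" using exp_ge_add_one_self[of "- (1 / 8)"] by simp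
    finally have "\<rho> ^ t \<le> exp (- (1 / 8)) ^ t" using rho0 by (intro power_mono)
    also have "\<dots> = exp (- real t / 8)"
      by (simp add: exp_of_nat_mult[symmetric])
    finally show ?thesis by (simp add: add_increasing2)
  qed
  have e1: "8 * real t ^ 2 / N \<le> real t / 16"
  proof -
    have "real (128 * t) \<le> real N" using t by (simp only: of_nat_le_iff)
    then have "real t * (128 * t) \<le> real t * N" by (intro mult_left_mono) auto
    then show ?thesis using N by (simp add: field_simps power2_eq_square)
  qed
  have e2: "8 * real t ^ 2 / N \<le> real t ^ 2 / (128 * real a)"
  proof -
    have "real (1024 * a) \<le> real N" using a(2) by (simp only: of_nat_le_iff)
    then have "real t ^ 2 * (1024 * a) \<le> real t ^ 2 * N"
      by (intro mult_left_mono) auto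
    then show ?thesis using N a(1) by (simp add: field_simps)
  qed
  have "exp (8 * real t ^ 2 / N) * (exp (- real t / 2) + \<rho> ^ t)
    \<le> exp (8 * real t ^ 2 / N) * (exp (- real t / 8) + (exp (- real t / 8) + exp (- (real t ^ 2 / (64 * real a)))))"
    using pow by (intro mult_left_mono add_mono) auto
  also have "\<dots> = 2 * exp (8 * real t ^ 2 / N - real t / 8) + exp (8 * real t ^ 2 / N - real t ^ 2 / (64 * real a))"
  proof -
    have "exp x * (exp y + (exp y + exp z)) = 2 * exp (x + y) + exp (x + z)" for x y z :: real
      by (simp add: exp_add distrib_left)
    from this[of "8 * real t ^ 2 / N" "- real t / 8" "- (real t ^ 2 / (64 * real a))"] show ?thesis by simp
  qed
  also have "\<dots> \<le> 2 * exp (- real t / 16) + exp (- (real t ^ 2 / (128 * real a)))"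
  proof (intro add_mono mult_left_mono)
    show "exp (8 * real t ^ 2 / N - real t / 8) \<le> exp (- real t / 16)" using e1 by simp
    have "real t ^ 2 / (64 * real a) = 2 * (real t ^ 2 / (128 * real a))" by simp
    then show "exp (8 * real t ^ 2 / N - real t ^ 2 / (64 * real a)) \<le> exp (- (real t ^ 2 / (128 * real a)))"
      using e2 by (subst exp_le_cancel_iff) linarith
  qed auto
  finally show ?thesis by (simp add: \<rho>_def)
qed

text \<open>The piece size 128 comes from here. The larger families contain at least 32 N vertices,
  and n \<le> 256 N makes (32 N)^2 / n at least 4 N. This beats the number of pairs of families, 4^N
  \<le> exp(2 N), and leaves exp(-2 N) \<le> exp(-n / 128).\<close>

lemma path_failure_bound:
  fixes N n :: nat and p :: real
  assumes n: "n > 0" and p: "1 / n \<le> p" "p \<le> 1" and N: "n \<le> 256 * N"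
  shows "4 ^ N * (1 - p) ^ (((N + 3) div 4 * 128)\<^sup>2) \<le> exp (- (n / 128))"
proof -
  define m where "m = (N + 3) div 4 * 128"
  have "32 * N \<le> m" unfolding m_def by linarith
  then have "(32 * N)\<^sup>2 \<le> m\<^sup>2" by (rule power_mono) simp
  then have m: "real ((32 * N)\<^sup>2) \<le> real (m\<^sup>2)" by (simp only: of_nat_le_iff)
  have nN: "real n \<le> 256 * N" using N by (metis of_nat_le_iff of_nat_mult of_nat_numeral)
  have "1 - p \<le> 1 + (- (1 / n))" using p by simp
  also have "\<dots> \<le> exp (- (1 / n))" by (rule exp_ge_add_one_self)
  finally have "(1 - p) ^ (m\<^sup>2) \<le> exp (- (1 / n)) ^ (m\<^sup>2)" using p by (intro power_mono) auto
  also have "\<dots> = exp (- (m\<^sup>2 / n))" by (simp add: exp_of_nat_mult[symmetric])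
  also have "\<dots> \<le> exp (- (4 * real N))"
  proof -
    have "real N * real n \<le> real N * real (256 * N)" using nN by (intro mult_left_mono) auto
    then have "4 * real N * n \<le> real ((32 * N)\<^sup>2)" by (simp add: power2_eq_square)
    also have "\<dots> \<le> real (m\<^sup>2)" by (rule m)
    finally show ?thesis using n by (simp add: field_simps)
  qed
  finally have 1: "(1 - p) ^ (m\<^sup>2) \<le> exp (- (4 * real N))" .
  have "(2::real) \<le> exp 1" using exp_ge_add_one_self[of 1] by simp
  then have "(4::real) \<le> exp 1 * exp 1" using mult_mono[of 2 "exp 1" 2 "exp (1::real)"] by simp
  then have "(4::real) ^ N \<le> (exp 1 * exp 1) ^ N" by (intro power_mono) auto
  also have "\<dots> = exp (2 * real N)"
    by (simp add: exp_of_nat_mult[symmetric] exp_add[symmetric])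
  finally have "4 ^ N * (1 - p) ^ (m\<^sup>2) \<le> exp (2 * real N) * exp (- (4 * real N))"
    using 1 p by (intro mult_mono) auto
  also have "\<dots> = exp (- (2 * real N))" by (simp add: exp_add[symmetric])
  also have "\<dots> \<le> exp (- (n / 128))" using nN by simp
  finally show ?thesis by (simp add: m_def)
qed

lemma independence_number_pos:
  assumes G: "simple_graph G" and "verts G \<noteq> {}"
  shows "independence_number G \<ge> 1"
proof -
  obtain v where v: "v \<in> verts G" using assms(2) by blast
  have "\<not> e \<subseteq> {v}" if "e \<in> edges G" for e
  proof
    assume "e \<subseteq> {v}"
    then have "card e \<le> 1" using card_mono[of "{v}" e] by simp
    then show False using that G by (auto simp: simple_graph_def all_pairs_def)
  qed
  then have "independent_set G {v}" using v by (simp add: independent_set_def)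
  from card_le_independence_number[OF G this] show ?thesis by simp
qed

text \<open>2^18 a \<le> n makes 128 a at most n / 2, hence n \<le> 256 N for the number N of
  pieces; then 2^18 = 256 * 1024 yields 1024 a \<le> N. Likewise 32768 = 256 * 128 and 512 = 256 * 2
  translate the conditions on \<open>t\<close> and \<open>r\<close> from n to N.\<close>

lemma prob_hadwiger_number_ge:
  fixes G :: "'a graph" and p :: real and t r n :: nat
  defines "a \<equiv> independence_number G"
  assumes G: "simple_graph G" and n: "card (verts G) = n" "n > 0" and a: "2 ^ 18 * a \<le> n"
    and p: "1 / n \<le> p" "p \<le> 1" and t: "t > 0" "32768 * t \<le> n" and r: "512 * (r * t) \<le> n"
  shows "1 - (exp (- (n / 128)) + real r ^ 2 * (2 * exp (- real t / 16) + exp (- (real t ^ 2 / (128 * real a)))))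
    \<le> measure_pmf.prob (binomial_random_graph (verts G) p)
        {R. r \<le> hadwiger_number (graph_union G R)}"
proof -
  have fin: "finite (verts G)" using G by (simp add: simple_graph_def)
  obtain X where X: "\<And>B. B \<in> X \<Longrightarrow> B \<subseteq> verts G \<and> card B = 128 \<and> cut_connected (edges G) B"
    and disj: "disjoint X" and cX: "n \<le> 128 * card X + 128 * a"
    using disjoint_connected_family[OF G, of 128] unfolding a_def n(1) by auto
  define N where "N = card X"
  have N: "n \<le> 256 * N" "1024 * a \<le> N" "128 * t \<le> N"
  proof -
    have "262144 * a \<le> n" using a by simp
    then show "n \<le> 256 * N" using cX unfolding N_def by linarith
    then show "1024 * a \<le> N" "128 * t \<le> N" using \<open>262144 * a \<le> n\<close> t(2) by linarith+
  qed
  have ne: "X \<noteq> {}" using N(1) n(2) by (auto simp: N_def)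
  have a1: "a \<ge> 1"
    unfolding a_def using n by (intro independence_number_pos[OF G]) auto
  let ?E = "4 ^ N * (1 - p) ^ (((N + 3) div 4 * 128)\<^sup>2) + real r ^ 2 *
      (exp (8 * real t ^ 2 / N) * (exp (- real t / 2) + (3 / 4 + exp (- (real t / N) * (N div (4 * a))) / 4) ^ t))"
  have "1 - ?E \<le> measure_pmf.prob (binomial_random_graph (verts G) p)
        {R. is_minor (complete_graph r) (graph_union G R)}"
    unfolding N_def
  proof (rule prob_complete_minor_ge[OF G X disj])
    show "0 \<le> p" using p(1) by (meson divide_nonneg_nonneg of_nat_0_le_iff order_trans zero_le_one)
    show "4 * independence_number G * (card X div (4 * a)) \<le> card X"
      unfolding a_def by (rule times_div_less_eq_dividend)
    show "2 * (r * t) \<le> card X" "4 * t \<le> card X" using r N unfolding N_def by linarith+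
  qed (use p t ne in auto)
  moreover have "?E \<le> exp (- (n / 128)) + real r ^ 2 * (2 * exp (- real t / 16) + exp (- (real t ^ 2 / (128 * real a))))"
    using path_failure_bound[OF n(2) p N(1)] nonadjacency_bound[OF a1 N(2,3)]
    by (intro add_mono mult_left_mono) auto
  moreover have "measure_pmf.prob (binomial_random_graph (verts G) p)
        {R. is_minor (complete_graph r) (graph_union G R)}
    \<le> measure_pmf.prob (binomial_random_graph (verts G) p) {R. r \<le> hadwiger_number (graph_union G R)}"
  proof -
    let ?M = "binomial_random_graph (verts G) p"
    \<comment> \<open>On the support \<open>R\<close> has the vertex set of \<open>G\<close>, so the
      union is finite and \<open>le_hadwiger_number\<close> applies.\<close>
    have "measure_pmf.prob ?M {R. is_minor (complete_graph r) (graph_union G R)}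
        = measure_pmf.prob ?M ({R. is_minor (complete_graph r) (graph_union G R)} \<inter> set_pmf ?M)"
      by (rule measure_Int_set_pmf[symmetric])
    also have "\<dots> \<le> measure_pmf.prob ?M {R. r \<le> hadwiger_number (graph_union G R)}"
    proof (intro measure_pmf.finite_measure_mono subsetI)
      fix R assume R: "R \<in> {R. is_minor (complete_graph r) (graph_union G R)} \<inter> set_pmf ?M"
      then have "verts R = verts G" by (auto simp: binomial_random_graph_def)
      then have "finite (verts (graph_union G R))" using fin by (simp add: graph_union_def)
      then show "R \<in> {R. r \<le> hadwiger_number (graph_union G R)}"
        using le_hadwiger_number R by blast
    qed simp
    finally show ?thesis .
  qed
  ultimately show ?thesis by linarith
qed

text \<open>Each exponential term is pushed below n^-3, so that the r^2 \<le> n^2 in the union bound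
  costs 3 / n. The hypothesis \<open>large\<close> involves only n, so it holds eventually and
  uniformly in \<open>G\<close>.\<close>

lemma prob_hadwiger_number_ge_asymptotic:
  fixes G :: "'a graph" and p :: real and n :: nat
  defines "s \<equiv> sqrt (ln n) * max (sqrt (independence_number G)) (ln n)"
  assumes G: "simple_graph G" and n: "card (verts G) = n" "ln n \<ge> 9"
    and a: "independence_number G \<le> (1 / 2 ^ 18) * real n"
    and p: "1 / n \<le> p" "p \<le> 1"
    and large: "2 ^ 20 * (sqrt (ln n) * (sqrt n + ln n)) \<le> n"
  shows "1 - (exp (- (n / 128)) + 3 / n)
    \<le> measure_pmf.prob (binomial_random_graph (verts G) p)
        {R. real (hadwiger_number (graph_union G R)) \<ge> 1 / 2 ^ 15 * (n / s)}"
proof -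
  define a where "a = independence_number G"
  define L where "L = ln (real n)"
  have L: "L \<ge> 9" using n(2) by (simp add: L_def)
  have n0: "n > 0" using n(2) by (cases n) auto
  have an: "2 ^ 18 * real a \<le> n" using a by (simp add: a_def field_simps)
  have an': "2 ^ 18 * a \<le> n"
  proof -
    have "real (2 ^ 18 * a) \<le> real n" using an by simp
    then show ?thesis by (simp only: of_nat_le_iff)
  qed
  have sL: "sqrt L \<ge> 3" using L real_le_rsqrt[of 3 L] by simp
  have s: "s = sqrt L * max (sqrt a) L" by (simp add: s_def L_def a_def)
  have s1: "s \<ge> sqrt L * L" unfolding s using sL L by (intro mult_left_mono) auto
  have s3: "3 * L \<le> sqrt L * L" using sL L by (intro mult_right_mono) auto
  have s_pos: "s \<ge> 27" using s1 s3 L by linarith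
  have s2: "s\<^sup>2 \<ge> L * a"
  proof -
    have "sqrt L * sqrt a \<le> s" unfolding s using L by (intro mult_left_mono) auto
    then have "(sqrt L * sqrt a)\<^sup>2 \<le> s\<^sup>2" using L by (intro power_mono) auto
    then show ?thesis using L by (simp add: power_mult_distrib)
  qed
  have sn: "2 ^ 20 * s \<le> n"
  proof -
    have "262144 * real a \<le> n" using an by simp
    then have "real a \<le> n" by linarith
    then have "sqrt a \<le> sqrt n" by simp
    moreover have "0 \<le> sqrt n" by simp
    ultimately have "max (sqrt a) L \<le> sqrt n + L" using L by linarith
    then have "s \<le> sqrt L * (sqrt n + L)" unfolding s using L by (intro mult_left_mono) auto
    then show ?thesis using large by (simp add: L_def)
  qed
  \<comment> \<open>The factor 20 serves both tails: t \<ge> 20 s \<ge> 60 ln n gives t / 16 \<ge> 3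
    ln n, and t^2 \<ge> 400 s^2 \<ge> 384 a ln n gives t^2 / (128 a) \<ge> 3 ln n.\<close>
  define t where "t = nat \<lceil>20 * s\<rceil>"
  have t1: "20 * s \<le> t" unfolding t_def by (rule real_nat_ceiling_ge)
  have t2: "t \<le> 21 * s"
    using s_pos unfolding t_def by linarith
  have t0: "t > 0" using t1 s_pos by (cases t) auto
  have tn: "32768 * t \<le> n"
  proof -
    have "real (32768 * t) \<le> n" using t2 sn s_pos by simp
    then show ?thesis by (simp only: of_nat_le_iff)
  qed
  \<comment> \<open>The path visits at least N / 2 \<ge> n / 512 pieces, t for each branch
    set.\<close>
  define r where "r = n div (512 * t)"
  have r: "512 * (r * t) \<le> n"
    using times_div_less_eq_dividend[of "512 * t" n] by (simp add: r_def mult_ac)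
  have r_le: "r \<le> n" by (simp add: r_def)
  \<comment> \<open>Rounding down costs at most a factor 2, so r \<ge> n / (1024 t); the constant
    follows from t \<le> 21 s and 1024 * 21 \<le> 2^15.\<close>
  have r_ge: "1 / 2 ^ 15 * (n / s) \<le> r"
  proof -
    have "n < 512 * t * r + 512 * t"
      using dividend_less_times_div[of "512 * t" n] t0 by (simp add: r_def)
    then have "n \<le> 1024 * (t * r)" using tn by (simp add: mult.assoc)
    then have "real n \<le> 1024 * (t * real r)"
      by (metis of_nat_le_iff of_nat_mult of_nat_numeral)
    also have "\<dots> \<le> 1024 * (21 * s * real r)" using t2 by (intro mult_left_mono mult_right_mono) auto
    also have "\<dots> \<le> 2 ^ 15 * (s * r)"
    proof -
      have "0 \<le> s * r" using s_pos by simp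
      then show ?thesis by (simp add: mult.assoc)
    qed
    finally show ?thesis using s_pos by (simp add: field_simps)
  qed
  have expL: "exp (- (3 * L)) = 1 / n ^ 3"
    using n0 by (simp add: exp_minus L_def exp_of_nat_mult[of 3, simplified] field_simps)
  have e1: "exp (- real t / 16) \<le> exp (- (3 * L))"
  proof -
    have "48 * L \<le> t" using t1 s1 s3 L by linarith
    then show ?thesis by simp
  qed
  have e2: "exp (- (real t ^ 2 / (128 * real a))) \<le> exp (- (3 * L))"
  proof -
    have "a \<ge> 1" unfolding a_def using n n0 by (intro independence_number_pos[OF G]) auto
    have "(20 * s)\<^sup>2 \<le> (real t)\<^sup>2" using t1 s_pos by (intro power_mono) auto
    then have "400 * (L * a) \<le> (real t)\<^sup>2" using s2 by (simp add: power_mult_distrib)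
    moreover have "384 * (L * a) \<le> 400 * (L * a)" using L by simp
    ultimately have "384 * (L * a) \<le> (real t)\<^sup>2" by linarith
    then have "3 * L \<le> real t ^ 2 / (128 * real a)" using \<open>a \<ge> 1\<close> by (simp add: field_simps)
    then show ?thesis by simp
  qed
  have "real r ^ 2 * (2 * exp (- real t / 16) + exp (- (real t ^ 2 / (128 * real a)))) \<le> real n ^ 2 * (3 * exp (- (3 * L)))"
  proof (rule mult_mono)
    show "2 * exp (- real t / 16) + exp (- (real t ^ 2 / (128 * real a))) \<le> 3 * exp (- (3 * L))"
      using e1 e2 by linarith
  qed (use r_le in \<open>auto intro!: power_mono\<close>)
  also have "\<dots> = 3 / n" unfolding expL using n0 by (simp add: field_simps power2_eq_square power3_eq_cube)
  finally have err: "real r ^ 2 * (2 * exp (- real t / 16) + exp (- (real t ^ 2 / (128 * real a)))) \<le> 3 / n" .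
  have "1 - (exp (- (n / 128)) + real r ^ 2 * (2 * exp (- real t / 16) + exp (- (real t ^ 2 / (128 * real a)))))
    \<le> measure_pmf.prob (binomial_random_graph (verts G) p) {R. r \<le> hadwiger_number (graph_union G R)}"
    unfolding a_def
    by (rule prob_hadwiger_number_ge[OF G n(1) n0 _ p t0 tn r]) (use an' in \<open>simp add: a_def\<close>)
  also have "\<dots> \<le> measure_pmf.prob (binomial_random_graph (verts G) p)
        {R. real (hadwiger_number (graph_union G R)) \<ge> 1 / 2 ^ 15 * (n / s)}"
  proof (intro measure_pmf.finite_measure_mono subsetI)
    fix R assume "R \<in> {R. r \<le> hadwiger_number (graph_union G R)}"
    then have "real r \<le> hadwiger_number (graph_union G R)" by simp
    then show "R \<in> {R. real (hadwiger_number (graph_union G R)) \<ge> 1 / 2 ^ 15 * (n / s)}"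
      using r_ge by simp
  qed simp
  finally show ?thesis using err by linarith
qed

theorem theorem1p1:
  fixes \<epsilon> :: real
  assumes "\<epsilon> > 0"
  shows "\<exists>\<alpha>::real. \<alpha> > 0 \<and> (\<exists>c::real. c > 0 \<and>
    (\<forall>G :: nat \<Rightarrow> nat graph.
       (\<forall>\<^sub>F n in sequentially.
          simple_graph (G n) \<and> card (verts (G n)) = n \<and>
          real (independence_number (G n)) \<le> \<alpha> * real n) \<longrightarrow>
       (\<lambda>n. measure_pmf.prob (binomial_random_graph (verts (G n)) ((1 + \<epsilon>) / real n))
          {R. real (hadwiger_number (graph_union (G n) R)) \<ge>
              c * (real n / (sqrt (ln (real n)) *
                     max (sqrt (real (independence_number (G n)))) (ln (real n))))})
         \<longlonglongrightarrow> 1))"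
\<comment> \<open>2^-18 is the density that keeps half of the vertices in pieces and gives 1024 a
  \<le> N; 2^-15 is the loss in the number of branch sets.\<close>
proof (rule exI[of _ "1 / 2 ^ 18"], intro conjI, simp, rule exI[of _ "1 / 2 ^ 15"], intro conjI allI impI, simp)
  fix G :: "nat \<Rightarrow> nat graph"
  assume G: "\<forall>\<^sub>F n in sequentially. simple_graph (G n) \<and> card (verts (G n)) = n \<and>
      real (independence_number (G n)) \<le> 1 / 2 ^ 18 * real n"
  let ?p = "\<lambda>n. measure_pmf.prob (binomial_random_graph (verts (G n)) ((1 + \<epsilon>) / real n))
          {R. real (hadwiger_number (graph_union (G n) R)) \<ge>
              1 / 2 ^ 15 * (real n / (sqrt (ln (real n)) *
                     max (sqrt (real (independence_number (G n)))) (ln (real n))))}"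
  have ev1: "\<forall>\<^sub>F n :: nat in sequentially. ln (real n) \<ge> 9" by real_asymp
  have ev2: "\<forall>\<^sub>F n :: nat in sequentially. 2 ^ 20 * (sqrt (ln (real n)) * (sqrt (real n) + ln (real n))) \<le> real n"
    by real_asymp
  have ev3: "\<forall>\<^sub>F n :: nat in sequentially. real n \<ge> 1 + \<epsilon>" by real_asymp
  have lower: "\<forall>\<^sub>F n in sequentially. 1 - (exp (- (real n / 128)) + 3 / real n) \<le> ?p n"
    using G ev1 ev2 ev3
  proof eventually_elim
    case (elim n)
    show ?case
    proof (rule prob_hadwiger_number_ge_asymptotic)
      show "1 / real n \<le> (1 + \<epsilon>) / real n" using assms by (intro divide_right_mono) auto
      show "(1 + \<epsilon>) / real n \<le> 1" using elim assms by simp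
    qed (use elim in auto)
  qed
  have upper: "\<forall>\<^sub>F n in sequentially. ?p n \<le> 1" by simp
  have "(\<lambda>n. 1 - (exp (- (real n / 128)) + 3 / real n)) \<longlonglongrightarrow> 1" by real_asymp
  from tendsto_sandwich[OF lower upper this tendsto_const] show "?p \<longlonglongrightarrow> 1" .
qed

end
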